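(* (1) Let $G\in\mathbf{B}^+(\mathcal H)$. Then for each $X\in\mathbf{B}^+(\mathcal H)$ the equality $$\tau_G(X)=X-[G]X$$ holds. Therefore, $\tau_G(X)=0$ if and only if $X$ is $G$-absolutely continuous. In addition $\tau_G([G]X)=0$ for all $X\in\mathbf{B}^+(\mathcal H)$. If $\mathrm{ran}\,\widetilde G^{1/2}=\mathrm{ran}\,G^{1/2}$ for some $\widetilde G\in\mathbf{B}^+(\mathcal H)$, then $$\tau_G(X)=X-[\widetilde G]X=\widetilde G+X-[G](\widetilde G+X);$$ hence $$\widetilde G=[G](\widetilde G+X)-[G]X\qquad\text{and}\qquad X-\tau_G(X)=[G](\widetilde G+X)-\widetilde G.$$ In addition $$\sum_{n=0}^\infty\left(\mu_G^{[n]}(X):G\right)=[G]X\quad\text{for all }X\in\mathbf{B}^+(\mathcal H),$$ where the series converges strongly. (2) For every $G\in\mathbf{B}^+(\mathcal H)$ and arbitrary $X_1,X_2\in\mathbf{B}^+(\mathcal H)$, $$\tau_G(X_1+X_2)\le\tau_G(X_1)+\tau_G(X_2).$$ (3) For $G,X\in\mathbf{B}^+(\mathcal H)$ the following statements are equivalent: (i) $\tau_G(X)\in\mathbf{B}^+_0(\mathcal H)$; (ii) $X\in\mathbf{B}^+_0(\mathcal H)$ and $([G]X):X^2=0$; (iii) $G+X\in\mathbf{B}^+_0(\mathcal H)$ and $\big([G](G+X)\big):(G+X)^2=0$.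
   Context: $\mathcal H$ is a complex Hilbert space; $\mathbf{B}^+(\mathcal H)$ is the cone of all bounded nonnegative self-adjoint operators in $\mathcal H$, and $\mathbf{B}^+_0(\mathcal H)$ is the subset of those with trivial kernel. For $X,G\in\mathbf{B}^+(\mathcal H)$ the parallel sum $X:G\in\mathbf{B}^+(\mathcal H)$ is the operator with quadratic form $((X:G)h,h)=\inf\{(Xf,f)+(Gg,g): f,g\in\mathcal H,\ h=f+g\}$. The mapping $\mu_G:\mathbf{B}^+(\mathcal H)\to\mathbf{B}^+(\mathcal H)$ is $\mu_G(X)=X-X:G$; $\mu_G^{[n]}$ is its $n$-th iterate ($\mu_G^{[0]}(X)=X$). Since $0\le\mu_G(X)\le X$, the sequence $\{\mu_G^{[n]}(X)\}$ is non-increasing, and $\tau_G(X)=\text{s-}\lim_{n\to\infty}\mu_G^{[n]}(X)\in\mathbf{B}^+(\mathcal H)$ (strong limit). For $A,B\in\mathbf{B}^+(\mathcal H)$, $[A]B=\text{s-}\lim_{n\to\infty}(nA:B)\in\mathbf{B}^+(\mathcal H)$, where $nA:B$ is the parallel sum of $nA$ and $B$. An operator $C\in\mathbf{B}^+(\mathcal H)$ is called $A$-absolutely continuous if there exists a nondecreasing sequence $\{C_n\}\subset\mathbf{B}^+(\mathcal H)$ such that $C=\text{s-}\lim_{n\to\infty}C_n$ and, for each $n$, $C_n\le\alpha_nA$ for some number $\alpha_n$. *)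

theory Defs
  imports "HOL-Analysis.Analysis"
begin

text \<open>
  The sort of complex Hilbert spaces. The inner product is linear in its first argument; the
  inherited real inner product is its real part, which makes the inherited norm the Hilbert norm
  and yields positive definiteness.
\<close>

class complex_hilbert = real_inner + banach +
  fixes scaleC :: "complex \<Rightarrow> 'a \<Rightarrow> 'a" (infixr \<open>*\<^sub>C\<close> 75)
    and cinner :: "'a \<Rightarrow> 'a \<Rightarrow> complex"
  assumes scaleC_add_right: "c *\<^sub>C (x + y) = c *\<^sub>C x + c *\<^sub>C y"
    and scaleC_add_left: "(c + d) *\<^sub>C x = c *\<^sub>C x + d *\<^sub>C x"
    and scaleC_scaleC: "c *\<^sub>C (d *\<^sub>C x) = (c * d) *\<^sub>C x"
    and scaleR_scaleC: "r *\<^sub>R x = complex_of_real r *\<^sub>C x"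
    and cinner_commute: "cinner x y = cnj (cinner y x)"
    and cinner_add_left: "cinner (x + y) z = cinner x z + cinner y z"
    and cinner_scaleC_left: "cinner (c *\<^sub>C x) y = c * cinner x y"
    and inner_eq_Re_cinner: "inner x y = Re (cinner x y)"

instantiation complex :: complex_hilbert
begin

definition "scaleC_complex (c :: complex) (x :: complex) = c * x"
definition "cinner_complex (x :: complex) (y :: complex) = x * cnj y"

instance
  by standard
    (auto simp: scaleC_complex_def cinner_complex_def algebra_simps scaleR_conv_of_real
      inner_complex_def)

end

text \<open>
  Operators live in the type \<open>'a \<Rightarrow>\<^sub>L 'a\<close> of bounded real-linear maps; complex linearity is part
  of \<open>Bplus\<close>. For the self-adjoint operators considered here \<open>(Ax,x)\<close> is real, so taking the
  real part in \<open>qform\<close> only changes its type.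
\<close>

definition qform :: "('a::complex_hilbert \<Rightarrow>\<^sub>L 'a) \<Rightarrow> 'a \<Rightarrow> real" where
  "qform A x = Re (cinner (blinfun_apply A x) x)"

definition Bplus :: "('a::complex_hilbert \<Rightarrow>\<^sub>L 'a) set" where
  "Bplus = {A. (\<forall>c x. blinfun_apply A (c *\<^sub>C x) = c *\<^sub>C blinfun_apply A x)
             \<and> (\<forall>x y. cinner (blinfun_apply A x) y = cinner x (blinfun_apply A y))
             \<and> (\<forall>x. 0 \<le> qform A x)}"

definition Bplus0 :: "('a::complex_hilbert \<Rightarrow>\<^sub>L 'a) set" where
  "Bplus0 = {A \<in> Bplus. {x. blinfun_apply A x = 0} = {0}}"

definition op_le :: "('a::complex_hilbert \<Rightarrow>\<^sub>L 'a) \<Rightarrow> ('a \<Rightarrow>\<^sub>L 'a) \<Rightarrow> bool" where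
  "op_le A B \<longleftrightarrow> B - A \<in> Bplus"

definition strong_tendsto ::
  "(nat \<Rightarrow> 'a::complex_hilbert \<Rightarrow>\<^sub>L 'a) \<Rightarrow> ('a \<Rightarrow>\<^sub>L 'a) \<Rightarrow> bool" where
  "strong_tendsto A T \<longleftrightarrow> (\<forall>x. (\<lambda>n. blinfun_apply (A n) x) \<longlonglongrightarrow> blinfun_apply T x)"

definition strong_sums ::
  "(nat \<Rightarrow> 'a::complex_hilbert \<Rightarrow>\<^sub>L 'a) \<Rightarrow> ('a \<Rightarrow>\<^sub>L 'a) \<Rightarrow> bool" where
  "strong_sums A T \<longleftrightarrow> strong_tendsto (\<lambda>N. \<Sum>n<N. A n) T"

definition strong_lim :: "(nat \<Rightarrow> 'a::complex_hilbert \<Rightarrow>\<^sub>L 'a) \<Rightarrow> 'a \<Rightarrow>\<^sub>L 'a" where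
  "strong_lim A = (THE T. strong_tendsto A T)"

text \<open>
  A self-adjoint operator on a complex Hilbert space is determined by its quadratic form, so at
  most one operator meets the description below; the infimum is over a nonempty set of
  nonnegative reals when \<open>X\<close> and \<open>G\<close> are in \<open>Bplus\<close>.
\<close>

definition parallel_sum ::
  "('a::complex_hilbert \<Rightarrow>\<^sub>L 'a) \<Rightarrow> ('a \<Rightarrow>\<^sub>L 'a) \<Rightarrow> 'a \<Rightarrow>\<^sub>L 'a" where
  "parallel_sum X G =
     (THE T. T \<in> Bplus \<and> (\<forall>h. qform T h = Inf {qform X f + qform G g |f g. h = f + g}))"

definition op_sqrt :: "('a::complex_hilbert \<Rightarrow>\<^sub>L 'a) \<Rightarrow> 'a \<Rightarrow>\<^sub>L 'a" where
  "op_sqrt A = (THE S. S \<in> Bplus \<and> S o\<^sub>L S = A)"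

definition mu :: "('a::complex_hilbert \<Rightarrow>\<^sub>L 'a) \<Rightarrow> ('a \<Rightarrow>\<^sub>L 'a) \<Rightarrow> 'a \<Rightarrow>\<^sub>L 'a" where
  "mu G X = X - parallel_sum X G"

definition tau :: "('a::complex_hilbert \<Rightarrow>\<^sub>L 'a) \<Rightarrow> ('a \<Rightarrow>\<^sub>L 'a) \<Rightarrow> 'a \<Rightarrow>\<^sub>L 'a" where
  "tau G X = strong_lim (\<lambda>n. (mu G ^^ n) X)"

text \<open>\<open>ac_part A B\<close> is the operator written \<open>[A]B\<close>.\<close>

definition ac_part :: "('a::complex_hilbert \<Rightarrow>\<^sub>L 'a) \<Rightarrow> ('a \<Rightarrow>\<^sub>L 'a) \<Rightarrow> 'a \<Rightarrow>\<^sub>L 'a" where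
  "ac_part A B = strong_lim (\<lambda>n. parallel_sum (real n *\<^sub>R A) B)"

definition abs_cont :: "('a::complex_hilbert \<Rightarrow>\<^sub>L 'a) \<Rightarrow> ('a \<Rightarrow>\<^sub>L 'a) \<Rightarrow> bool" where
  "abs_cont A C \<longleftrightarrow> C \<in> Bplus \<and>
     (\<exists>D :: nat \<Rightarrow> 'a \<Rightarrow>\<^sub>L 'a. (\<forall>n. D n \<in> Bplus) \<and> (\<forall>n. op_le (D n) (D (Suc n))) \<and>
        strong_tendsto D C \<and> (\<forall>n. \<exists>\<alpha>::real. op_le (D n) (\<alpha> *\<^sub>R A)))"

end

theory Submission
  imports Defs
begin

text \<open>
  Everything rests on one singularity property: for the limit \<open>T = \<tau>\<^sub>G(X)\<close> and every \<open>h\<close> there are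
  \<open>g n\<close> such that the form of \<open>T\<close> at \<open>h - g n\<close> and the form of \<open>X + G - T\<close> at \<open>g n\<close> both tend to
  \<open>0\<close>. If \<open>S \<le> Y + X\<close>, where \<open>S\<close> and \<open>Y\<close> are dominated by multiples of \<open>G\<close>, replacing \<open>h\<close> by
  \<open>h - g n\<close> removes \<open>T\<close> from the right-hand side, so \<open>S \<le> Y + X - T\<close>; this bounds all the
  parallel sums \<open>nG : (Y + X)\<close> from above. Conversely \<open>X\<close> minus its \<open>n\<close>-th iterate is at most \<open>nG\<close>,
  which gives the lower bound. For part (3), \<open>L = ([G]X) : X\<^sup>2\<close> satisfies \<open>L \<le> X\<^sup>2\<close>, so \<open>L h = X w\<close>
  for some \<open>w\<close>, and singularity forces \<open>T w = 0\<close>.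

  The analysis takes place over real Hilbert spaces; complex linearity is recovered because all
  constructions preserve the commutant, in particular commutation with complex scalars.
\<close>

section \<open>Positive operators on a real Hilbert space\<close>

text \<open>The relation \<open>par T G = 0\<close> follows at once from the convergence of the
  iterates, but it is too weak. It controls the form of \<open>G\<close> along \<open>g n\<close>,
  whereas \<open>X - T\<close> is only a strong limit of operators dominated by multiples of
  \<open>G\<close> and need not be dominated itself. Passing from \<open>h\<close> to
  \<open>h - g n\<close> must leave the form of \<open>X - T\<close> unchanged in the limit, hence
  the demand on \<open>X + G - T\<close>. It is met by pulling \<open>X\<close> and \<open>G\<close>
  back from commuting operators on a product space, where a vanishing parallel sum forces a
  vanishing product. The real theory applies to that product space as it stands. Over the reals a
  nonnegative form does not force symmetry, so \<open>posop\<close> asks for both.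

  The hypothesis on the ranges of square roots enters only as mutual domination of \<open>G\<close>
  and \<open>G'\<close> up to constants, by Douglas's lemma. Adding to \<open>X\<close> an operator
  dominated by \<open>G\<close> does not change the limit; so (iii) in part (3) is (ii) for
  \<open>G + X\<close>.\<close>

definition posop :: "('a::real_inner \<Rightarrow>\<^sub>L 'a) \<Rightarrow> bool" where
  "posop A \<longleftrightarrow> (\<forall>x y. A x \<bullet> y = x \<bullet> A y) \<and> (\<forall>x. 0 \<le> A x \<bullet> x)"

lemma posop_sym: "posop A \<Longrightarrow> A x \<bullet> y = x \<bullet> A y"
  and posop_nonneg: "posop A \<Longrightarrow> 0 \<le> A x \<bullet> x"
  by (auto simp: posop_def)

lemma posop_swap: "posop A \<Longrightarrow> A x \<bullet> y = A y \<bullet> x"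
  by (metis inner_commute posop_sym)

lemma posop_zero [simp]: "posop 0"
  by (simp add: posop_def)

lemma posop_id [simp]: "posop id_blinfun"
  by (simp add: posop_def)

lemma posop_add: "posop A \<Longrightarrow> posop B \<Longrightarrow> posop (A + B)"
  by (auto simp: posop_def blinfun.add_left inner_add_left inner_add_right)

lemma posop_scaleR: "posop A \<Longrightarrow> 0 \<le> r \<Longrightarrow> posop (r *\<^sub>R A)"
  by (auto simp: posop_def blinfun.scaleR_left)

lemma posop_diff_iff:
  assumes "posop A" "posop B"
  shows "posop (B - A) \<longleftrightarrow> (\<forall>x. A x \<bullet> x \<le> B x \<bullet> x)"
  using assms by (simp add: posop_def blinfun.diff_left inner_diff_left inner_diff_right)

lemma posop_square: "posop A \<Longrightarrow> posop (A o\<^sub>L A)"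
  by (simp add: posop_def) (metis inner_ge_zero)

lemma posop_form_add:
  assumes "posop A"
  shows "A (x + y) \<bullet> (x + y) = A x \<bullet> x + 2 * (A x \<bullet> y) + A y \<bullet> y"
  using posop_swap[OF assms, of y x]
  by (simp add: blinfun.add_right inner_add_left inner_add_right)

lemma posop_form_diff:
  assumes "posop A"
  shows "A (x - y) \<bullet> (x - y) = A x \<bullet> x - 2 * (A x \<bullet> y) + A y \<bullet> y"
  using posop_swap[OF assms, of y x]
  by (simp add: blinfun.diff_right inner_diff_left inner_diff_right)

lemma quadratic_nonneg_imp_discriminant:
  fixes a b c :: real
  assumes "0 \<le> c" "\<And>t. 0 \<le> a + 2 * t * b + t\<^sup>2 * c"
  shows "b\<^sup>2 \<le> a * c"
proof (cases "c = 0")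
  case True
  have "b = 0"
  proof (rule ccontr)
    assume "b \<noteq> 0"
    \<comment> \<open>For \<open>c = 0\<close> this \<open>t\<close> makes the expression equal to
      \<open>-1\<close>.\<close>
    with assms(2)[of "- (a + 1) / (2 * b)"] True show False by (simp add: field_simps)
  qed
  then show ?thesis using True by simp
next
  case False
  with assms(1) have "c > 0" by simp
  then show ?thesis
    using assms(2)[of "- b / c"] by (simp add: field_simps power2_eq_square)
qed

lemma posop_Cauchy_Schwarz:
  assumes "posop A"
  shows "(A x \<bullet> y)\<^sup>2 \<le> (A x \<bullet> x) * (A y \<bullet> y)"
proof (rule quadratic_nonneg_imp_discriminant[OF posop_nonneg[OF assms]])
  fix t :: real
  show "0 \<le> A x \<bullet> x + 2 * t * (A x \<bullet> y) + t\<^sup>2 * (A y \<bullet> y)"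
    using posop_nonneg[OF assms, of "x + t *\<^sub>R y"]
    by (simp add: posop_form_add[OF assms] blinfun.scaleR_right power2_eq_square ac_simps)
qed

lemma form_le_norm: "A x \<bullet> x \<le> norm A * (norm x)\<^sup>2" for A :: "'a::real_inner \<Rightarrow>\<^sub>L 'a"
proof -
  have "A x \<bullet> x \<le> norm (A x) * norm x" by (rule norm_cauchy_schwarz)
  also have "\<dots> \<le> (norm A * norm x) * norm x" by (intro mult_right_mono norm_blinfun norm_ge_zero)
  finally show ?thesis by (simp add: power2_eq_square ac_simps)
qed

text \<open>Cauchy-Schwarz for the form of \<open>A\<close> at \<open>y = A x\<close>, with one
  factor \<open>(norm (A x))^2\<close> cancelled. It is the passage from small forms to small
  vectors.\<close>

lemma posop_norm_le_form:
  assumes "posop A" and c: "0 \<le> c" "\<And>x. A x \<bullet> x \<le> c * (norm x)\<^sup>2"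
  shows "(norm (A x))\<^sup>2 \<le> c * (A x \<bullet> x)"
proof (cases "A x = 0")
  case False
  have "((norm (A x))\<^sup>2)\<^sup>2 \<le> (A x \<bullet> x) * (A (A x) \<bullet> A x)"
    using posop_Cauchy_Schwarz[OF assms(1), of x "A x"] by (simp add: power2_norm_eq_inner)
  also have "\<dots> \<le> (A x \<bullet> x) * (c * (norm (A x))\<^sup>2)"
    by (intro mult_left_mono c posop_nonneg[OF assms(1)])
  finally have "(norm (A x))\<^sup>2 * (norm (A x))\<^sup>2 \<le> (c * (A x \<bullet> x)) * (norm (A x))\<^sup>2"
    by (simp add: power2_eq_square ac_simps)
  then show ?thesis by (rule mult_right_le_imp_le) (use False in simp)
qed (use c posop_nonneg[OF assms(1)] in simp)

lemma posop_norm_le: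
  assumes "posop A" and c: "0 \<le> c" "\<And>x. A x \<bullet> x \<le> c * (norm x)\<^sup>2"
  shows "norm A \<le> c"
proof (rule norm_blinfun_bound[OF c(1)])
  fix x
  have "(norm (A x))\<^sup>2 \<le> c * (A x \<bullet> x)" by (rule posop_norm_le_form[OF assms])
  also have "\<dots> \<le> c * (c * (norm x)\<^sup>2)" by (intro mult_left_mono c)
  finally have "(norm (A x))\<^sup>2 \<le> (c * norm x)\<^sup>2" by (simp add: power2_eq_square ac_simps)
  then show "norm (A x) \<le> c * norm x" using c(1) by (simp add: power2_le_iff_abs_le)
qed

lemma posop_norm_square_le: "posop A \<Longrightarrow> (norm (A x))\<^sup>2 \<le> norm A * (A x \<bullet> x)"
  by (intro posop_norm_le_form form_le_norm norm_ge_zero)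

lemma posop_form_eq_0:
  assumes "posop A" "A x \<bullet> x \<le> 0" shows "A x = 0"
proof -
  have "A x \<bullet> x = 0" using assms posop_nonneg[of A x] by linarith
  then show ?thesis using posop_norm_square_le[OF assms(1), of x] by simp
qed

lemma posop_kernel_mono:
  fixes A B :: "'a::real_inner \<Rightarrow>\<^sub>L 'a"
  assumes "posop A" "\<And>x. A x \<bullet> x \<le> c * (B x \<bullet> x)" "B x = 0"
  shows "A x = 0"
  using assms(2)[of x] assms(3) by (intro posop_form_eq_0[OF assms(1)]) simp

lemma posop_form_tendsto_0:
  assumes "posop A" "(\<lambda>n. A (g n) \<bullet> g n) \<longlonglongrightarrow> 0"
  shows "(\<lambda>n. A (g n)) \<longlonglongrightarrow> 0"
proof (rule tendsto_norm_zero_cancel)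
  have "(\<lambda>n. (norm (A (g n)))\<^sup>2) \<longlonglongrightarrow> 0"
  proof (rule real_tendsto_sandwich[of "\<lambda>_. 0"])
    show "(\<lambda>n. norm A * (A (g n) \<bullet> g n)) \<longlonglongrightarrow> 0"
      using tendsto_mult_left[OF assms(2), of "norm A"] by simp
  qed (use posop_norm_square_le[OF assms(1)] in auto)
  from tendsto_real_sqrt[OF this] show "(\<lambda>n. norm (A (g n))) \<longlonglongrightarrow> 0" by simp
qed

text \<open>The cross term tends to \<open>0\<close> because the vectors \<open>A (g n)\<close> do;
  the vectors \<open>g n\<close> themselves may be unbounded.\<close>

lemma posop_form_shift_tendsto:
  assumes "posop A" "(\<lambda>n. A (g n) \<bullet> g n) \<longlonglongrightarrow> 0"
  shows "(\<lambda>n. A (h - g n) \<bullet> (h - g n)) \<longlonglongrightarrow> A h \<bullet> h"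
proof -
  have *: "A (h - g n) \<bullet> (h - g n) = A h \<bullet> h - 2 * (A (g n) \<bullet> h) + A (g n) \<bullet> g n" for n
    using posop_form_diff[OF assms(1), of h "g n"] posop_swap[OF assms(1), of h "g n"] by simp
  have "(\<lambda>n. A h \<bullet> h - 2 * (A (g n) \<bullet> h) + A (g n) \<bullet> g n) \<longlonglongrightarrow> A h \<bullet> h - 2 * (0 \<bullet> h) + 0"
    by (intro tendsto_intros posop_form_tendsto_0 assms)
  then show ?thesis unfolding * by simp
qed

lemma posop_eqI:
  assumes "posop A" "posop B" "\<And>x. A x \<bullet> x = B x \<bullet> x"
  shows "A = B"
proof (rule blinfun_eqI)
  fix x
  have "posop (B - A)" using assms by (simp add: posop_diff_iff)
  then have "(B - A) x = 0"
    by (rule posop_form_eq_0) (simp add: assms(3) blinfun.diff_left inner_diff_left)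
  then show "A x = B x" by (simp add: blinfun.diff_left)
qed

section \<open>Strong limits of bounded and of monotone sequences\<close>

lemma blinfun_pointwise_limit:
  fixes A :: "nat \<Rightarrow> 'a::real_normed_vector \<Rightarrow>\<^sub>L 'b::real_normed_vector"
  assumes "\<And>x. convergent (\<lambda>n. A n x)" "\<And>n. norm (A n) \<le> c"
  obtains T :: "'a \<Rightarrow>\<^sub>L 'b" where "\<And>x. (\<lambda>n. A n x) \<longlonglongrightarrow> T x"
proof -
  define f where "f x = lim (\<lambda>n. A n x)" for x
  have f: "(\<lambda>n. A n x) \<longlonglongrightarrow> f x" for x
    unfolding f_def using assms(1) by (simp add: convergent_LIMSEQ_iff)
  have "bounded_linear f"
  proof (rule bounded_linear_intro[of f c])
    fix x y and r :: real
    have "(\<lambda>n. A n (x + y)) \<longlonglongrightarrow> f x + f y"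
      unfolding blinfun.add_right by (intro tendsto_add f)
    then show "f (x + y) = f x + f y" using f LIMSEQ_unique by blast
    have "(\<lambda>n. A n (r *\<^sub>R x)) \<longlonglongrightarrow> r *\<^sub>R f x"
      unfolding blinfun.scaleR_right by (intro tendsto_intros f)
    then show "f (r *\<^sub>R x) = r *\<^sub>R f x" using f LIMSEQ_unique by blast
    have "norm (A n x) \<le> norm x * c" for n
      using order_trans[OF norm_blinfun[of "A n" x] mult_right_mono[OF assms(2)[of n] norm_ge_zero]]
      by (simp add: mult.commute)
    then show "norm (f x) \<le> norm x * c"
      by (intro LIMSEQ_le_const2[OF tendsto_norm[OF f[of x]]]) auto
  qed
  then show thesis using f that[of "Blinfun f"] by (simp add: bounded_linear_Blinfun_apply)
qed

lemma posop_limit: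
  fixes T :: "'a::real_inner \<Rightarrow>\<^sub>L 'a"
  assumes "\<And>n. posop (A n)" "\<And>x. (\<lambda>n. A n x) \<longlonglongrightarrow> T x"
  shows "posop T"
  unfolding posop_def
proof (intro conjI allI)
  fix x y
  have 1: "(\<lambda>n. A n x \<bullet> y) \<longlonglongrightarrow> T x \<bullet> y" by (intro tendsto_intros assms(2))
  have "(\<lambda>n. x \<bullet> A n y) \<longlonglongrightarrow> x \<bullet> T y" by (intro tendsto_intros assms(2))
  then have "(\<lambda>n. A n x \<bullet> y) \<longlonglongrightarrow> x \<bullet> T y" by (simp add: posop_sym[OF assms(1)])
  with 1 show "T x \<bullet> y = x \<bullet> T y" by (rule LIMSEQ_unique)
  have "(\<lambda>n. A n x \<bullet> x) \<longlonglongrightarrow> T x \<bullet> x" by (intro tendsto_intros assms(2))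
  then show "0 \<le> T x \<bullet> x"
    by (rule LIMSEQ_le_const) (use assms(1) posop_nonneg in blast)
qed

text \<open>Vigier's theorem. The forms decrease and are bounded below, hence Cauchy; as the form of
  \<open>A m - A n\<close> is at most \<open>norm (A 0) * (norm x)^2\<close>,
  \<open>posop_norm_le_form\<close> turns Cauchy forms into Cauchy vectors.\<close>

lemma posop_decseq_convergent:
  fixes A :: "nat \<Rightarrow> 'a::{real_inner,banach} \<Rightarrow>\<^sub>L 'a"
  assumes pos: "\<And>n. posop (A n)" and dec: "\<And>n x. A (Suc n) x \<bullet> x \<le> A n x \<bullet> x"
  obtains T :: "'a \<Rightarrow>\<^sub>L 'a" where "posop T" "\<And>x. (\<lambda>n. A n x) \<longlonglongrightarrow> T x" "\<And>n x. T x \<bullet> x \<le> A n x \<bullet> x"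
proof -
  have mono: "A n x \<bullet> x \<le> A m x \<bullet> x" if "m \<le> n" for m n x
    using lift_Suc_antimono_le[of "\<lambda>n. A n x \<bullet> x", OF dec that] by simp
  have bd: "(A m - A n) x \<bullet> x \<le> norm (A 0) * (norm x)\<^sup>2" for m n x
  proof -
    have "(A m - A n) x \<bullet> x \<le> A m x \<bullet> x"
      using posop_nonneg[OF pos[of n], of x] by (simp add: blinfun.diff_left inner_diff_left)
    also have "\<dots> \<le> A 0 x \<bullet> x" by (rule mono) simp
    also have "\<dots> \<le> norm (A 0) * (norm x)\<^sup>2" by (rule form_le_norm)
    finally show ?thesis .
  qed
  have key: "(norm (A m x - A n x))\<^sup>2 \<le> norm (A 0) * (A m x \<bullet> x - A n x \<bullet> x)" if "m \<le> n" for m n x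
  proof -
    have "posop (A m - A n)" using mono[OF that] by (simp add: posop_diff_iff pos)
    from posop_norm_le_form[OF this norm_ge_zero bd, of x] show ?thesis
      by (simp add: blinfun.diff_left inner_diff_left)
  qed
  have "convergent (\<lambda>n. A n x)" for x
  proof -
    have "Bseq (\<lambda>n. A n x \<bullet> x)"
      using mono[of 0 _ x] posop_nonneg[OF pos, of _ x]
      by (intro BseqI'[of _ "A 0 x \<bullet> x"]) auto
    then have "Cauchy (\<lambda>n. A n x \<bullet> x)"
      using mono by (intro convergent_Cauchy Bseq_monoseq_convergent) (auto simp: monoseq_def)
    have "Cauchy (\<lambda>n. A n x)"
    proof (rule metric_CauchyI)
      fix e :: real assume "e > 0"
      \<comment> \<open>Adding \<open>1\<close> keeps the divisor positive when
        \<open>A 0 = 0\<close>.\<close>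
      then have "e\<^sup>2 / (norm (A 0) + 1) > 0" by (simp add: add_nonneg_pos)
      from metric_CauchyD[OF \<open>Cauchy (\<lambda>n. A n x \<bullet> x)\<close> this] obtain N
        where N: "\<And>m n. m \<ge> N \<Longrightarrow> n \<ge> N \<Longrightarrow> \<bar>A m x \<bullet> x - A n x \<bullet> x\<bar> < e\<^sup>2 / (norm (A 0) + 1)"
        by (auto simp: dist_real_def)
      have *: "norm (A m x - A n x) < e" if "m \<le> n" "m \<ge> N" for m n
      proof -
        have n1: "norm (A 0) + 1 > 0" by (simp add: add_nonneg_pos)
        have "(norm (A m x - A n x))\<^sup>2 \<le> norm (A 0) * (A m x \<bullet> x - A n x \<bullet> x)" by (rule key[OF that(1)])
        also have "\<dots> \<le> (norm (A 0) + 1) * (A m x \<bullet> x - A n x \<bullet> x)"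
          using mono[OF that(1), of x] by (intro mult_right_mono) auto
        also have "\<dots> < e\<^sup>2"
          using N[of m n] that n1 mono[OF that(1), of x] by (simp add: field_simps)
        finally show ?thesis using \<open>e > 0\<close> by (simp add: power2_less_imp_less)
      qed
      show "\<exists>M. \<forall>m\<ge>M. \<forall>n\<ge>M. dist (A m x) (A n x) < e"
      proof (intro exI[of _ N] allI impI)
        fix m n assume "m \<ge> N" "n \<ge> N"
        then show "dist (A m x) (A n x) < e"
          using *[of m n] *[of n m] by (cases "m \<le> n") (auto simp: dist_norm norm_minus_commute)
      qed
    qed
    then show ?thesis by (simp add: Cauchy_convergent)
  qed
  moreover have "norm (A n) \<le> norm (A 0)" for n
    by (rule posop_norm_le[OF pos norm_ge_zero])
      (use mono[of 0 n] form_le_norm[of "A 0"] order_trans in blast)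
  ultimately obtain T :: "'a \<Rightarrow>\<^sub>L 'a" where T: "\<And>x. (\<lambda>n. A n x) \<longlonglongrightarrow> T x"
    using blinfun_pointwise_limit by blast
  show thesis
  proof (rule that[OF _ T])
    show "posop T" by (rule posop_limit[OF pos T])
    fix n x
    have "(\<lambda>n. A n x \<bullet> x) \<longlonglongrightarrow> T x \<bullet> x" by (intro tendsto_intros T)
    then show "T x \<bullet> x \<le> A n x \<bullet> x"
      by (rule LIMSEQ_le_const2) (use mono in auto)
  qed
qed

lemma posop_incseq_convergent:
  fixes A :: "nat \<Rightarrow> 'a::{real_inner,banach} \<Rightarrow>\<^sub>L 'a"
  assumes pos: "\<And>n. posop (A n)" and inc: "\<And>n x. A n x \<bullet> x \<le> A (Suc n) x \<bullet> x"
    and B: "posop B" "\<And>n x. A n x \<bullet> x \<le> B x \<bullet> x"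
  obtains T :: "'a \<Rightarrow>\<^sub>L 'a" where "posop T" "\<And>x. (\<lambda>n. A n x) \<longlonglongrightarrow> T x" "\<And>n x. A n x \<bullet> x \<le> T x \<bullet> x"
    "\<And>x. T x \<bullet> x \<le> B x \<bullet> x"
proof -
  have "posop (B - A n)" for n using B by (simp add: posop_diff_iff pos)
  then obtain T :: "'a \<Rightarrow>\<^sub>L 'a" where T: "posop T" "\<And>x. (\<lambda>n. (B - A n) x) \<longlonglongrightarrow> T x"
      "\<And>n x. T x \<bullet> x \<le> (B - A n) x \<bullet> x"
    using posop_decseq_convergent[of "\<lambda>n. B - A n"] inc
    by (auto simp: blinfun.diff_left inner_diff_left)
  have lim: "(\<lambda>n. A n x) \<longlonglongrightarrow> (B - T) x" for x
    using tendsto_diff[OF tendsto_const[of "B x"] T(2)[of x]] by (simp add: blinfun.diff_left)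
  show thesis
  proof (rule that[OF posop_limit[OF pos lim] lim])
    show "A n x \<bullet> x \<le> (B - T) x \<bullet> x" for n x
      using T(3)[of x n] by (simp add: blinfun.diff_left inner_diff_left)
    show "(B - T) x \<bullet> x \<le> B x \<bullet> x" for x
      using posop_nonneg[OF T(1), of x] by (simp add: blinfun.diff_left inner_diff_left)
  qed
qed

section \<open>Ranges, resolvents and parallel sums\<close>

lemma mem_range_if_inner_le:
  fixes S :: "'a::{real_inner,banach} \<Rightarrow>\<^sub>L 'a"
  assumes S: "posop S" and le: "\<And>f. v \<bullet> f \<le> c * norm (S f)"
  obtains w where "S w = v"
proof -
  \<comment> \<open>\<open>w\<close> is the limit of \<open>S (f n)\<close> along a minimising sequence of \<open>F\<close>; the parallelogram law
     makes \<open>S (f n)\<close> a Cauchy sequence, and \<open>S w = v\<close> is the Euler equation.\<close>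
  define F where "F f = (norm (S f))\<^sup>2 - 2 * (v \<bullet> f)" for f
  have "F f \<ge> - c\<^sup>2" for f
  proof -
    have "0 \<le> (norm (S f) - c)\<^sup>2" by simp
    then show ?thesis using le[of f] unfolding F_def by (simp add: power2_diff algebra_simps)
  qed
  then have bdd: "bdd_below (range F)" by (intro bdd_belowI[of _ "- c\<^sup>2"]) auto
  define m where "m = (INF f. F f)"
  have mF: "m \<le> F f" for f unfolding m_def using bdd by (simp add: cINF_lower)
  have "\<exists>f. F f < m + 1 / real (Suc n)" for n
  proof -
    have "Inf (range F) < m + 1 / real (Suc n)" unfolding m_def by simp
    from cInf_lessD[OF _ this] show ?thesis by auto
  qed
  then obtain f where f: "\<And>n. F (f n) < m + 1 / real (Suc n)" by metis
  have par: "(norm (S (f j) - S (f k)))\<^sup>2 \<le> 2 * (F (f j) - m) + 2 * (F (f k) - m)" for j k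
  proof -
    have "4 * F ((1/2) *\<^sub>R (f j + f k))
        = 2 * F (f j) + 2 * F (f k) - (norm (S (f j) - S (f k)))\<^sup>2"
      unfolding F_def power2_norm_eq_inner blinfun.scaleR_right blinfun.add_right
      by (simp add: inner_add_left inner_add_right inner_diff_left inner_diff_right
          inner_commute algebra_simps)
    then show ?thesis using mF[of "(1/2) *\<^sub>R (f j + f k)"] by argo
  qed
  have Flim: "(\<lambda>n. F (f n)) \<longlonglongrightarrow> m"
  proof (rule real_tendsto_sandwich[of "\<lambda>_. m"])
    show "(\<lambda>n. m + 1 / real (Suc n)) \<longlonglongrightarrow> m"
      using tendsto_add[OF tendsto_const[of m] LIMSEQ_Suc[OF lim_1_over_n]] by simp
  qed (use mF f less_imp_le in \<open>blast intro: always_eventually\<close>)+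
  have "Cauchy (\<lambda>n. S (f n))"
  proof (rule metric_CauchyI)
    fix e :: real assume "e > 0"
    then have "e\<^sup>2 / 4 > 0" by simp
    from LIMSEQ_D[OF Flim this] obtain N where N: "\<And>n. n \<ge> N \<Longrightarrow> \<bar>F (f n) - m\<bar> < e\<^sup>2 / 4" by auto
    show "\<exists>M. \<forall>j\<ge>M. \<forall>k\<ge>M. dist (S (f j)) (S (f k)) < e"
    proof (intro exI[of _ N] allI impI)
      fix j k assume j: "j \<ge> N" and k: "k \<ge> N"
      have "(norm (S (f j) - S (f k)))\<^sup>2 < e\<^sup>2" using par[of j k] N[OF j] N[OF k] by argo
      then show "dist (S (f j)) (S (f k)) < e"
        using \<open>e > 0\<close> by (simp add: dist_norm power2_less_imp_less)
    qed
  qed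
  then obtain w where w: "(\<lambda>n. S (f n)) \<longlonglongrightarrow> w" using Cauchy_convergent convergent_def by blast
  have "w \<bullet> S g = v \<bullet> g" for g
  proof -
    \<comment> \<open>The constant term \<open>0\<close> in the discriminant lemma leaves
      \<open>b^2 \<le> 0\<close>: this is the first-order condition at the minimum, obtained without
      differentiating.\<close>
    have "(w \<bullet> S g - v \<bullet> g)\<^sup>2 \<le> 0 * (norm (S g))\<^sup>2"
    proof (rule quadratic_nonneg_imp_discriminant)
      fix t
      have "m \<le> F (f n) + 2 * t * (S (f n) \<bullet> S g - v \<bullet> g) + t\<^sup>2 * (norm (S g))\<^sup>2" for n
        using mF[of "f n + t *\<^sub>R g"]
        unfolding F_def power2_norm_eq_inner blinfun.scaleR_right blinfun.add_right
        by (simp add: inner_add_left inner_add_right inner_commute power2_eq_square algebra_simps)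
      moreover have "(\<lambda>n. F (f n) + 2 * t * (S (f n) \<bullet> S g - v \<bullet> g) + t\<^sup>2 * (norm (S g))\<^sup>2)
          \<longlonglongrightarrow> m + 2 * t * (w \<bullet> S g - v \<bullet> g) + t\<^sup>2 * (norm (S g))\<^sup>2"
        by (intro tendsto_intros w Flim)
      ultimately have "m \<le> m + 2 * t * (w \<bullet> S g - v \<bullet> g) + t\<^sup>2 * (norm (S g))\<^sup>2"
        by (intro LIMSEQ_le_const) auto
      then show "0 \<le> 0 + 2 * t * (w \<bullet> S g - v \<bullet> g) + t\<^sup>2 * (norm (S g))\<^sup>2" by simp
    qed simp
    then show ?thesis by simp
  qed
  then have "(S w - v) \<bullet> (S w - v) = 0"
    by (metis posop_sym[OF S] inner_diff_left cancel_comm_monoid_add_class.diff_cancel)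
  then show thesis using that[of w] by simp
qed

text \<open>The lower bound gives injectivity and bounds the inverse. Surjectivity comes from the
  range criterion, which every \<open>v\<close> satisfies because \<open>norm f\<close> is at most
  \<open>norm (A f) / e\<close>. The last clause is the commutant property from which complex
  linearity is later recovered.\<close>

lemma posop_inverse:
  fixes A :: "'a::{real_inner,banach} \<Rightarrow>\<^sub>L 'a"
  assumes A: "posop A" and e: "e > 0" "\<And>x. e * (norm x)\<^sup>2 \<le> A x \<bullet> x"
  obtains R :: "'a \<Rightarrow>\<^sub>L 'a" where "posop R" "\<And>x. A (R x) = x" "\<And>x. R (A x) = x"
    "\<And>C. A o\<^sub>L C = C o\<^sub>L A \<Longrightarrow> R o\<^sub>L C = C o\<^sub>L R"
proof -
  have low: "e * norm x \<le> norm (A x)" for x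
  proof (cases "x = 0")
    case False
    have "(e * norm x) * norm x \<le> norm (A x) * norm x"
      using e(2)[of x] norm_cauchy_schwarz[of "A x" x] by (simp add: power2_eq_square)
    then show ?thesis using False by simp
  qed simp
  have "inj A"
  proof (rule injI)
    fix x y assume "A x = A y"
    then have "A (x - y) = 0" by (simp add: blinfun.diff_right)
    then show "x = y" using low[of "x - y"] e(1) by (simp add: mult_le_0_iff)
  qed
  have "\<exists>w. A w = v" for v
  proof (rule mem_range_if_inner_le[OF A])
    fix f
    have "v \<bullet> f \<le> norm v * norm f" by (rule norm_cauchy_schwarz)
    also have "\<dots> \<le> norm v * (norm (A f) / e)"
      using low[of f] e(1) by (intro mult_left_mono) (auto simp: field_simps)
    finally show "v \<bullet> f \<le> (norm v / e) * norm (A f)" by simp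
  qed blast
  then have "surj A" by (metis surjI surj_f_inv_f surj_def)
  define R where "R = Blinfun (inv A)"
  have AR: "A (inv A x) = x" for x using \<open>surj A\<close> by (rule surj_f_inv_f)
  have "bounded_linear (inv A)"
  proof (rule bounded_linear_intro[of _ "1 / e"])
    fix x y and r :: real
    show "inv A (x + y) = inv A x + inv A y"
      by (rule injD[OF \<open>inj A\<close>]) (simp add: AR blinfun.add_right)
    show "inv A (r *\<^sub>R x) = r *\<^sub>R inv A x"
      by (rule injD[OF \<open>inj A\<close>]) (simp add: AR blinfun.scaleR_right)
    show "norm (inv A x) \<le> norm x * (1 / e)"
      using low[of "inv A x"] e(1) by (simp add: AR field_simps)
  qed
  then have R: "R x = inv A x" for x by (simp add: R_def bounded_linear_Blinfun_apply)
  have RA: "R (A x) = x" for x by (simp add: R \<open>inj A\<close>)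
  have AR': "A (R x) = x" for x by (simp add: R AR)
  show thesis
  proof (rule that[OF _ AR' RA])
    show "posop R"
      unfolding posop_def
    proof (intro conjI allI)
      fix x y
      show "R x \<bullet> y = x \<bullet> R y" using posop_sym[OF A, of "R x" "R y"] by (simp add: AR')
      show "0 \<le> R x \<bullet> x"
        using posop_nonneg[OF A, of "R x"] by (simp add: AR' inner_commute)
    qed
    fix C assume "A o\<^sub>L C = C o\<^sub>L A"
    then have AC: "A (C x) = C (A x)" for x by (metis blinfun_apply_blinfun_compose)
    show "R o\<^sub>L C = C o\<^sub>L R"
    proof (rule blinfun_eqI)
      fix x
      have "R (C x) = R (C (A (R x)))" by (simp add: AR')
      also have "\<dots> = C (R x)" by (simp add: AC[symmetric] RA)
      finally show "(R o\<^sub>L C) x = (C o\<^sub>L R) x" by simp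
    qed
  qed
qed

text \<open>The inverse of \<open>B + \<epsilon>\<close> at \<open>\<epsilon> = 1 / (n + 1)\<close>;
  the successor keeps the shift finite at \<open>n = 0\<close>.\<close>

definition resolvent :: "('a::{real_inner,banach} \<Rightarrow>\<^sub>L 'a) \<Rightarrow> nat \<Rightarrow> 'a \<Rightarrow>\<^sub>L 'a" where
  "resolvent B n = (SOME R. posop R \<and> (\<forall>x. B (R x) + (1 / real (Suc n)) *\<^sub>R R x = x)
     \<and> (\<forall>C. B o\<^sub>L C = C o\<^sub>L B \<longrightarrow> R o\<^sub>L C = C o\<^sub>L R))"

lemma resolvent:
  assumes "posop B"
  shows "posop (resolvent B n)"
    and "B (resolvent B n x) + (1 / real (Suc n)) *\<^sub>R resolvent B n x = x"
    and "B o\<^sub>L C = C o\<^sub>L B \<Longrightarrow> resolvent B n o\<^sub>L C = C o\<^sub>L resolvent B n"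
proof -
  let ?e = "1 / real (Suc n)" and ?A = "B + (1 / real (Suc n)) *\<^sub>R id_blinfun"
  have A: "posop ?A" by (intro posop_add assms posop_scaleR posop_id) simp
  have e: "?e * (norm x)\<^sup>2 \<le> ?A x \<bullet> x" for x
    using posop_nonneg[OF assms, of x]
    by (simp add: blinfun.add_left blinfun.scaleR_left inner_add_left power2_norm_eq_inner)
  have "?e > 0" by simp
  obtain R :: "'a \<Rightarrow>\<^sub>L 'a" where R: "posop R" "\<And>x. ?A (R x) = x" "\<And>x. R (?A x) = x"
      "\<And>C. ?A o\<^sub>L C = C o\<^sub>L ?A \<Longrightarrow> R o\<^sub>L C = C o\<^sub>L R"
    by (rule posop_inverse[OF A \<open>?e > 0\<close> e]) (rule that)
  have comm: "?A o\<^sub>L C = C o\<^sub>L ?A" if "B o\<^sub>L C = C o\<^sub>L B" for C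
  proof (rule blinfun_eqI)
    fix x
    have "B (C x) = C (B x)" using that by (metis blinfun_apply_blinfun_compose)
    then show "(?A o\<^sub>L C) x = (C o\<^sub>L ?A) x"
      by (simp add: blinfun.add_left blinfun.scaleR_left blinfun.add_right blinfun.scaleR_right)
  qed
  have "posop R \<and> (\<forall>x. B (R x) + (1 / real (Suc n)) *\<^sub>R R x = x)
     \<and> (\<forall>C. B o\<^sub>L C = C o\<^sub>L B \<longrightarrow> R o\<^sub>L C = C o\<^sub>L R)"
    using R(1,2) R(4)[OF comm] by (simp add: blinfun.add_left blinfun.scaleR_left)
  from someI[of "\<lambda>R. posop R \<and> (\<forall>x. B (R x) + (1 / real (Suc n)) *\<^sub>R R x = x)
     \<and> (\<forall>C. B o\<^sub>L C = C o\<^sub>L B \<longrightarrow> R o\<^sub>L C = C o\<^sub>L R)", OF this]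
  show "posop (resolvent B n)"
    and "B (resolvent B n x) + (1 / real (Suc n)) *\<^sub>R resolvent B n x = x"
    and "B o\<^sub>L C = C o\<^sub>L B \<Longrightarrow> resolvent B n o\<^sub>L C = C o\<^sub>L resolvent B n"
    unfolding resolvent_def by blast+
qed

text \<open>
  The parallel sum is the limit of \<open>B - B (A + B + \<epsilon>)\<^sup>-\<^sup>1 B\<close> as \<open>\<epsilon>\<close> tends to \<open>0\<close>; the form of the
  approximant at \<open>h\<close> is the minimum over \<open>f\<close> of \<open>A f \<bullet> f + B (h - f) \<bullet> (h - f) + \<epsilon> (norm f)\<^sup>2\<close>.
\<close>

lemma parallel_sum_exists:
  fixes A B :: "'a::{real_inner,banach} \<Rightarrow>\<^sub>L 'a"
  assumes A: "posop A" and B: "posop B"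
  obtains T :: "'a \<Rightarrow>\<^sub>L 'a" where "posop T"
    "\<And>h f. T h \<bullet> h \<le> A f \<bullet> f + B (h - f) \<bullet> (h - f)"
    "\<And>h c. (\<And>f. c \<le> A f \<bullet> f + B (h - f) \<bullet> (h - f)) \<Longrightarrow> c \<le> T h \<bullet> h"
    "\<And>C. A o\<^sub>L C = C o\<^sub>L A \<Longrightarrow> B o\<^sub>L C = C o\<^sub>L B \<Longrightarrow> T o\<^sub>L C = C o\<^sub>L T"
proof -
  let ?e = "\<lambda>n. 1 / real (Suc n)"
  define R where "R n = resolvent (A + B) n" for n
  define D where "D n = B - (B o\<^sub>L R n o\<^sub>L B)" for n
  have AB: "posop (A + B)" by (intro posop_add A B)
  note R = resolvent[OF AB, folded R_def]
  define q where "q n h f = A f \<bullet> f + B (h - f) \<bullet> (h - f) + ?e n * (norm f)\<^sup>2" for n h f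
  have D_le: "D n h \<bullet> h \<le> q n h f" and D_eq: "D n h \<bullet> h = q n h (R n (B h))" for n h f
  proof -
    let ?C = "A + B + ?e n *\<^sub>R id_blinfun"
    have C: "posop ?C" by (intro posop_add AB posop_scaleR posop_id) simp
    have CR: "?C (R n y) = y" for y
      using R(2)[of n y] by (simp add: blinfun.add_left blinfun.scaleR_left)
    \<comment> \<open>Completing the square in \<open>f\<close>: the minimiser is
      \<open>R n (B h)\<close>, since \<open>?C\<close> maps it to \<open>B h\<close>.\<close>
    have *: "q n h f = D n h \<bullet> h + ?C (f - R n (B h)) \<bullet> (f - R n (B h))" for f
    proof -
      have "?C (f - R n (B h)) \<bullet> (f - R n (B h))
          = ?C f \<bullet> f - 2 * (?C (R n (B h)) \<bullet> f) + ?C (R n (B h)) \<bullet> R n (B h)"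
        using posop_form_diff[OF C] posop_swap[OF C] by metis
      also have "\<dots> = ?C f \<bullet> f - 2 * (B h \<bullet> f) + B h \<bullet> R n (B h)" by (simp only: CR)
      also have "?C f \<bullet> f = A f \<bullet> f + B f \<bullet> f + ?e n * (norm f)\<^sup>2"
        by (simp add: blinfun.add_left blinfun.scaleR_left inner_add_left power2_norm_eq_inner)
      finally have "?C (f - R n (B h)) \<bullet> (f - R n (B h)) =
        A f \<bullet> f + B f \<bullet> f + ?e n * (norm f)\<^sup>2 - 2 * (B h \<bullet> f) + B h \<bullet> R n (B h)" .
      moreover have "D n h \<bullet> h = B h \<bullet> h - B h \<bullet> R n (B h)"
        using posop_swap[OF B, of "R n (B h)" h] by (simp add: D_def blinfun.diff_left inner_diff_left)
      moreover have "B (h - f) \<bullet> (h - f) = B h \<bullet> h - 2 * (B h \<bullet> f) + B f \<bullet> f"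
        by (rule posop_form_diff[OF B])
      ultimately show ?thesis unfolding q_def by linarith
    qed
    show "D n h \<bullet> h \<le> q n h f" using posop_nonneg[OF C] by (simp add: *)
    show "D n h \<bullet> h = q n h (R n (B h))" unfolding * by simp
  qed
  have Dpos: "posop (D n)" for n
    unfolding posop_def
  proof (intro conjI allI)
    fix x y
    show "D n x \<bullet> y = x \<bullet> D n y"
      by (simp add: D_def blinfun.diff_left inner_diff_left inner_diff_right
          posop_sym[OF B] posop_sym[OF R(1)])
    show "0 \<le> D n x \<bullet> x"
      unfolding D_eq q_def using posop_nonneg[OF A] posop_nonneg[OF B] by (intro add_nonneg_nonneg) auto
  qed
  have Ddec: "D (Suc n) h \<bullet> h \<le> D n h \<bullet> h" for n h
  proof -
    \<comment> \<open>The minimiser for \<open>n\<close> is a competitor for \<open>Suc n\<close>,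
      and the penalty there is smaller.\<close>
    have "D (Suc n) h \<bullet> h \<le> q (Suc n) h (R n (B h))" by (rule D_le)
    also have "\<dots> \<le> q n h (R n (B h))"
      unfolding q_def by (intro add_left_mono mult_right_mono) (auto simp: frac_le)
    finally show ?thesis by (simp add: D_eq)
  qed
  from posop_decseq_convergent[of D, OF Dpos Ddec] obtain T :: "'a \<Rightarrow>\<^sub>L 'a" where
    T: "posop T" "\<And>x. (\<lambda>n. D n x) \<longlonglongrightarrow> T x" "\<And>n x. T x \<bullet> x \<le> D n x \<bullet> x" by blast
  show thesis
  proof (rule that[OF T(1)])
    fix h f
    have "(\<lambda>n. q n h f) \<longlonglongrightarrow> A f \<bullet> f + B (h - f) \<bullet> (h - f) + 0 * (norm f)\<^sup>2"
      unfolding q_def by (intro tendsto_intros LIMSEQ_Suc[OF lim_1_over_n])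
    moreover have "T h \<bullet> h \<le> q n h f" for n using T(3) D_le order_trans by blast
    ultimately show "T h \<bullet> h \<le> A f \<bullet> f + B (h - f) \<bullet> (h - f)"
      by (intro LIMSEQ_le_const) auto
  next
    fix h c assume c: "\<And>f. c \<le> A f \<bullet> f + B (h - f) \<bullet> (h - f)"
    have "c \<le> D n h \<bullet> h" for n
      unfolding D_eq q_def using c[of "R n (B h)"] by (simp add: add_increasing2)
    moreover have "(\<lambda>n. D n h \<bullet> h) \<longlonglongrightarrow> T h \<bullet> h" by (intro tendsto_intros T(2))
    ultimately show "c \<le> T h \<bullet> h" by (intro LIMSEQ_le_const) auto
  next
    fix C assume "A o\<^sub>L C = C o\<^sub>L A" "B o\<^sub>L C = C o\<^sub>L B"
    then have AC: "A (C x) = C (A x)" and BC: "B (C x) = C (B x)" for x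
      by (metis blinfun_apply_blinfun_compose)+
    have "(A + B) o\<^sub>L C = C o\<^sub>L (A + B)"
      by (rule blinfun_eqI) (simp add: AC BC blinfun.add_left blinfun.add_right)
    from R(3)[OF this] have RC: "R n (C x) = C (R n x)" for n x
      by (metis blinfun_apply_blinfun_compose)
    have DC: "D n (C x) = C (D n x)" for n x
      by (simp add: D_def blinfun.diff_left blinfun.diff_right BC RC)
    show "T o\<^sub>L C = C o\<^sub>L T"
    proof (rule blinfun_eqI)
      fix x
      have "(\<lambda>n. C (D n x)) \<longlonglongrightarrow> C (T x)" by (intro tendsto_intros T(2))
      with T(2)[of "C x"] show "(T o\<^sub>L C) x = (C o\<^sub>L T) x"
        unfolding DC by (simp add: LIMSEQ_unique)
    qed
  qed
qed

text \<open>The second and third clauses together say that the form is the infimum over all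
  decompositions, without mentioning a set. The commutant clause is part of the choice so that it
  can be used for complex scalars.\<close>

definition par :: "('a::real_inner \<Rightarrow>\<^sub>L 'a) \<Rightarrow> ('a \<Rightarrow>\<^sub>L 'a) \<Rightarrow> 'a \<Rightarrow>\<^sub>L 'a" where
  "par A B = (SOME T. posop T \<and> (\<forall>h f. T h \<bullet> h \<le> A f \<bullet> f + B (h - f) \<bullet> (h - f)) \<and>
    (\<forall>h c. (\<forall>f. c \<le> A f \<bullet> f + B (h - f) \<bullet> (h - f)) \<longrightarrow> c \<le> T h \<bullet> h) \<and>
    (\<forall>C. A o\<^sub>L C = C o\<^sub>L A \<longrightarrow> B o\<^sub>L C = C o\<^sub>L B \<longrightarrow> T o\<^sub>L C = C o\<^sub>L T))"

context
  fixes A B :: "'a::{real_inner,banach} \<Rightarrow>\<^sub>L 'a"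
  assumes A: "posop A" and B: "posop B"
begin

lemma par_all: "posop (par A B) \<and> (\<forall>h f. par A B h \<bullet> h \<le> A f \<bullet> f + B (h - f) \<bullet> (h - f)) \<and>
    (\<forall>h c. (\<forall>f. c \<le> A f \<bullet> f + B (h - f) \<bullet> (h - f)) \<longrightarrow> c \<le> par A B h \<bullet> h) \<and>
    (\<forall>C. A o\<^sub>L C = C o\<^sub>L A \<longrightarrow> B o\<^sub>L C = C o\<^sub>L B \<longrightarrow> par A B o\<^sub>L C = C o\<^sub>L par A B)"
  unfolding par_def by (rule someI_ex, rule parallel_sum_exists[OF A B]) blast

lemma par_pos: "posop (par A B)"
  and par_le: "par A B h \<bullet> h \<le> A f \<bullet> f + B (h - f) \<bullet> (h - f)"
  and par_greatest: "(\<And>f. c \<le> A f \<bullet> f + B (h - f) \<bullet> (h - f)) \<Longrightarrow> c \<le> par A B h \<bullet> h"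
  and par_commute: "A o\<^sub>L C = C o\<^sub>L A \<Longrightarrow> B o\<^sub>L C = C o\<^sub>L B \<Longrightarrow> par A B o\<^sub>L C = C o\<^sub>L par A B"
  using par_all by blast+

lemma par_le_left: "par A B h \<bullet> h \<le> A h \<bullet> h"
  and par_le_right: "par A B h \<bullet> h \<le> B h \<bullet> h"
  using par_le[of h h] par_le[of h 0] by simp_all

text \<open>An infimum equal to \<open>0\<close> yields decompositions of \<open>h\<close> with
  value below \<open>1 / (n + 1)\<close>; both summands are nonnegative, so each of them tends to
  \<open>0\<close>.\<close>

lemma par_zero_sequence:
  assumes "par A B h = 0"
  obtains g where "(\<lambda>n::nat. A (h - g n) \<bullet> (h - g n)) \<longlonglongrightarrow> 0" "(\<lambda>n. B (g n) \<bullet> g n) \<longlonglongrightarrow> 0"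
proof -
  have "\<exists>f. A f \<bullet> f + B (h - f) \<bullet> (h - f) < 1 / real (Suc n)" for n
  proof (rule ccontr)
    assume "\<nexists>f. A f \<bullet> f + B (h - f) \<bullet> (h - f) < 1 / real (Suc n)"
    then have "1 / real (Suc n) \<le> par A B h \<bullet> h" by (intro par_greatest) (simp add: not_less)
    then show False using assms by simp
  qed
  then obtain f where f: "\<And>n. A (f n) \<bullet> f n + B (h - f n) \<bullet> (h - f n) < 1 / real (Suc n)" by metis
  have fA: "A (f n) \<bullet> f n \<le> 1 / real (Suc n)"
    and fB: "B (h - f n) \<bullet> (h - f n) \<le> 1 / real (Suc n)" for n
    using f[of n] posop_nonneg[OF A, of "f n"] posop_nonneg[OF B, of "h - f n"] by linarith+
  have lim: "u \<longlonglongrightarrow> 0" if "\<And>n. 0 \<le> u n" "\<And>n. u n \<le> 1 / real (Suc n)" for u :: "nat \<Rightarrow> real"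
    by (rule real_tendsto_sandwich[OF _ _ tendsto_const LIMSEQ_Suc[OF lim_1_over_n]]) (use that in auto)
  show thesis
  proof (rule that[of "\<lambda>n. h - f n"])
    show "(\<lambda>n. A (h - (h - f n)) \<bullet> (h - (h - f n))) \<longlonglongrightarrow> 0"
      using posop_nonneg[OF A] fA by (intro lim) auto
    show "(\<lambda>n. B (h - f n) \<bullet> (h - f n)) \<longlonglongrightarrow> 0"
      using posop_nonneg[OF B] fB by (intro lim) auto
  qed
qed

end

section \<open>Square roots and congruences\<close>

lemma posop_sqrt_contraction:
  fixes A :: "'a::{real_inner,banach} \<Rightarrow>\<^sub>L 'a"
  assumes A: "posop A" and le: "\<And>x. A x \<bullet> x \<le> (norm x)\<^sup>2"
  obtains S :: "'a \<Rightarrow>\<^sub>L 'a" where "posop S" "S o\<^sub>L S = A" "\<And>C. A o\<^sub>L C = C o\<^sub>L A \<Longrightarrow> S o\<^sub>L C = C o\<^sub>L S"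
proof -
  \<comment> \<open>\<open>Y n\<close> is the iteration for \<open>I - sqrt A\<close>; its increments are dominated in norm by those of
     the scalar iteration \<open>y\<close> with the same recursion, so it converges in norm.\<close>
  define N where "N = id_blinfun - A"
  define y :: "nat \<Rightarrow> real" where "y = rec_nat 0 (\<lambda>_ t. (1 + t\<^sup>2) / 2)"
  define Y where "Y = rec_nat (0 :: 'a \<Rightarrow>\<^sub>L 'a) (\<lambda>_ T. (1/2) *\<^sub>R (N + (T o\<^sub>L T)))"
  have y0: "y 0 = 0" and ySuc: "y (Suc n) = (1 + (y n)\<^sup>2) / 2" for n by (simp_all add: y_def)
  have Y0: "Y 0 = 0" and YSuc: "Y (Suc n) = (1/2) *\<^sub>R (N + (Y n o\<^sub>L Y n))" for n by (simp_all add: Y_def)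
  have N: "posop N"
    unfolding N_def using le by (subst posop_diff_iff[OF A posop_id]) (simp add: power2_norm_eq_inner)
  have "norm N \<le> 1"
    by (rule posop_norm_le[OF N])
      (use posop_nonneg[OF A] in \<open>auto simp: N_def blinfun.diff_left inner_diff_left power2_norm_eq_inner\<close>)
  have y01: "0 \<le> y n \<and> y n \<le> 1" for n
  proof (induction n)
    case (Suc n)
    then have "(y n)\<^sup>2 \<le> 1" by (simp add: power_le_one)
    then show ?case unfolding ySuc by simp
  qed (simp add: y0)
  have Yn: "norm (Y n) \<le> y n" for n
  proof (induction n)
    case (Suc n)
    have "norm (Y (Suc n)) \<le> (norm N + norm (Y n o\<^sub>L Y n)) / 2"
      unfolding YSuc by (simp add: norm_triangle_ineq)
    also have "norm (Y n o\<^sub>L Y n) \<le> norm (Y n) * norm (Y n)" by (rule norm_blinfun_compose)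
    also have "\<dots> \<le> y n * y n" using Suc y01[of n] by (intro mult_mono) auto
    finally show ?case using \<open>norm N \<le> 1\<close> unfolding ySuc by (simp add: power2_eq_square)
  qed (simp add: y0 Y0)
  have Yd: "norm (Y (Suc n) - Y n) \<le> y (Suc n) - y n" for n
  proof (induction n)
    case 0
    then show ?case using \<open>norm N \<le> 1\<close> by (simp add: y0 Y0 ySuc YSuc)
  next
    case (Suc n)
    let ?D = "Y (Suc n) - Y n"
    \<comment> \<open>The difference of the two squares, factored so that no commutation of
      \<open>Y n\<close> with \<open>Y (Suc n)\<close> is involved.\<close>
    have "Y (Suc (Suc n)) - Y (Suc n) = (1/2) *\<^sub>R ((?D o\<^sub>L Y (Suc n)) + (Y n o\<^sub>L ?D))"
      unfolding YSuc[of "Suc n"] YSuc[of n, symmetric]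
      by (subst (3) YSuc[of n])
        (intro blinfun_eqI, simp add: blinfun.add_left blinfun.diff_left blinfun.scaleR_left
          blinfun.diff_right algebra_simps)
    then have "norm (Y (Suc (Suc n)) - Y (Suc n))
        \<le> (norm (?D o\<^sub>L Y (Suc n)) + norm (Y n o\<^sub>L ?D)) / 2"
      by (simp add: norm_triangle_ineq)
    also have "\<dots> \<le> (norm ?D * norm (Y (Suc n)) + norm (Y n) * norm ?D) / 2"
      by (intro divide_right_mono add_mono norm_blinfun_compose) simp
    also have "\<dots> \<le> ((y (Suc n) - y n) * y (Suc n) + y n * (y (Suc n) - y n)) / 2"
      using Suc y01[of n] y01[of "Suc n"] Yn[of n] Yn[of "Suc n"] order_trans[OF norm_ge_zero Suc]
      by (intro divide_right_mono add_mono mult_mono) auto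
    also have "\<dots> = y (Suc (Suc n)) - y (Suc n)"
      unfolding ySuc[of "Suc n"] ySuc[of n] by (simp add: power2_eq_square field_simps)
    finally show ?case .
  qed
  have ymono: "y n \<le> y m" if "n \<le> m" for m n
    using that by (rule lift_Suc_mono_le[rotated]) (use order_trans[OF norm_ge_zero Yd] in simp)
  have Ydiff: "norm (Y m - Y n) \<le> y m - y n" if "n \<le> m" for m n
    using that
  proof (induction rule: dec_induct)
    case (step k)
    have "norm (Y (Suc k) - Y n) \<le> norm (Y (Suc k) - Y k) + norm (Y k - Y n)"
      using norm_triangle_ineq[of "Y (Suc k) - Y k" "Y k - Y n"] by simp
    then show ?case using step.IH Yd[of k] by linarith
  qed simp
  have "Bseq y" using y01 by (intro BseqI'[of _ 1]) auto
  then have "Cauchy y"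
    using ymono by (intro convergent_Cauchy Bseq_monoseq_convergent) (auto simp: monoseq_def)
  have "Cauchy Y"
  proof (rule metric_CauchyI)
    fix e :: real assume "e > 0"
    from metric_CauchyD[OF \<open>Cauchy y\<close> this] obtain M
      where M: "\<And>m n. m \<ge> M \<Longrightarrow> n \<ge> M \<Longrightarrow> \<bar>y m - y n\<bar> < e" by (auto simp: dist_real_def)
    have *: "norm (Y m - Y n) < e" if "n \<le> m" "n \<ge> M" for m n
      using Ydiff[OF that(1)] M[of m n] that by linarith
    show "\<exists>M. \<forall>m\<ge>M. \<forall>n\<ge>M. dist (Y m) (Y n) < e"
    proof (intro exI[of _ M] allI impI)
      fix m n assume "m \<ge> M" "n \<ge> M"
      then show "dist (Y m) (Y n) < e"
        using *[of m n] *[of n m] by (cases "m \<le> n") (auto simp: dist_norm norm_minus_commute)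
    qed
  qed
  then obtain L where L: "Y \<longlonglongrightarrow> L" using Cauchy_convergent convergent_def by blast
  have Lx: "(\<lambda>n. Y n x) \<longlonglongrightarrow> L x" for x by (intro tendsto_intros L)
  \<comment> \<open>The fixed-point equation \<open>2 L = I - A + L^2\<close> is
    \<open>(I - L)^2 = A\<close>.\<close>
  have "(\<lambda>n. (1/2) *\<^sub>R (N + (Y n o\<^sub>L Y n))) \<longlonglongrightarrow> (1/2) *\<^sub>R (N + (L o\<^sub>L L))"
    by (intro tendsto_intros bounded_bilinear.tendsto[OF bounded_bilinear_blinfun_compose] L)
  then have "L = (1/2) *\<^sub>R (N + (L o\<^sub>L L))"
    unfolding YSuc[symmetric] using LIMSEQ_Suc[OF L] LIMSEQ_unique by blast
  then have LL: "L x = (1/2) *\<^sub>R (x - A x + L (L x))" for x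
    by (metis N_def blinfun.add_left blinfun.diff_left blinfun.scaleR_left
        blinfun_apply_blinfun_compose blinfun_apply_id_blinfun)
  have Ypos: "posop (Y n)" for n
    by (induction n) (simp_all add: Y0 YSuc posop_scaleR posop_add N posop_square)
  have Lpos: "posop L" by (rule posop_limit[OF Ypos Lx])
  have "norm (Y n) \<le> 1" for n using Yn[of n] y01[of n] by linarith
  then have "norm L \<le> 1" by (intro LIMSEQ_le_const2[OF tendsto_norm[OF L]]) auto
  have "L x \<bullet> x \<le> id_blinfun x \<bullet> x" for x
  proof -
    have "L x \<bullet> x \<le> norm L * (norm x)\<^sup>2" by (rule form_le_norm)
    also have "\<dots> \<le> 1 * (norm x)\<^sup>2" using \<open>norm L \<le> 1\<close> by (intro mult_right_mono) auto
    finally show ?thesis by (simp add: power2_norm_eq_inner)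
  qed
  then have Spos: "posop (id_blinfun - L)" using posop_diff_iff[OF Lpos posop_id] by blast
  show thesis
  proof (rule that[OF Spos])
    show "(id_blinfun - L) o\<^sub>L (id_blinfun - L) = A"
    proof (rule blinfun_eqI)
      fix x
      have "2 *\<^sub>R L x = x - A x + L (L x)" by (subst LL) simp
      then show "((id_blinfun - L) o\<^sub>L (id_blinfun - L)) x = A x"
        by (simp add: blinfun.diff_left blinfun.diff_right scaleR_2 algebra_simps)
    qed
    fix C assume "A o\<^sub>L C = C o\<^sub>L A"
    then have AC: "A (C x) = C (A x)" for x by (metis blinfun_apply_blinfun_compose)
    have YC: "Y n (C x) = C (Y n x)" for n x
      by (induction n arbitrary: x)
        (simp_all add: Y0 YSuc N_def AC blinfun.add_left blinfun.scaleR_left blinfun.diff_left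
          blinfun.add_right blinfun.scaleR_right blinfun.diff_right blinfun.zero_left)
    have "L (C x) = C (L x)" for x
    proof -
      have "(\<lambda>n. C (Y n x)) \<longlonglongrightarrow> C (L x)" by (intro tendsto_intros Lx)
      then show ?thesis using Lx[of "C x"] unfolding YC by (rule LIMSEQ_unique[symmetric])
    qed
    then show "(id_blinfun - L) o\<^sub>L C = C o\<^sub>L (id_blinfun - L)"
      by (intro blinfun_eqI) (simp add: blinfun.diff_left blinfun.diff_right)
  qed
qed

lemma posop_sqrt:
  fixes A :: "'a::{real_inner,banach} \<Rightarrow>\<^sub>L 'a"
  assumes A: "posop A"
  obtains S :: "'a \<Rightarrow>\<^sub>L 'a" where "posop S" "S o\<^sub>L S = A" "\<And>C. A o\<^sub>L C = C o\<^sub>L A \<Longrightarrow> S o\<^sub>L C = C o\<^sub>L S"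
proof -
  \<comment> \<open>Rescaling to a contraction; the summand \<open>1\<close> covers
    \<open>A = 0\<close>.\<close>
  define c where "c = norm A + 1"
  have c: "c > 0" by (simp add: c_def add_nonneg_pos)
  have pos: "posop ((1/c) *\<^sub>R A)" using c by (intro posop_scaleR A) simp
  have le: "((1/c) *\<^sub>R A) x \<bullet> x \<le> (norm x)\<^sup>2" for x
  proof -
    have "A x \<bullet> x \<le> norm A * (norm x)\<^sup>2" by (rule form_le_norm)
    also have "\<dots> \<le> c * (norm x)\<^sup>2" by (intro mult_right_mono) (auto simp: c_def)
    finally show ?thesis using c by (simp add: blinfun.scaleR_left field_simps)
  qed
  obtain S :: "'a \<Rightarrow>\<^sub>L 'a" where S: "posop S" "S o\<^sub>L S = (1/c) *\<^sub>R A"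
      "\<And>C. ((1/c) *\<^sub>R A) o\<^sub>L C = C o\<^sub>L ((1/c) *\<^sub>R A) \<Longrightarrow> S o\<^sub>L C = C o\<^sub>L S"
    by (rule posop_sqrt_contraction[OF pos le]) (rule that)
  have SS: "S (S x) = (1/c) *\<^sub>R A x" for x
    using S(2) by (metis blinfun.scaleR_left blinfun_apply_blinfun_compose)
  show thesis
  proof (rule that[of "sqrt c *\<^sub>R S"])
    show "posop (sqrt c *\<^sub>R S)" using c by (intro posop_scaleR S) simp
    show "(sqrt c *\<^sub>R S) o\<^sub>L (sqrt c *\<^sub>R S) = A"
      using c by (intro blinfun_eqI) (simp add: blinfun.scaleR_left blinfun.scaleR_right SS)
    fix C assume "A o\<^sub>L C = C o\<^sub>L A"
    then have AC: "A (C x) = C (A x)" for x by (metis blinfun_apply_blinfun_compose)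
    have "((1/c) *\<^sub>R A) o\<^sub>L C = C o\<^sub>L ((1/c) *\<^sub>R A)"
      by (rule blinfun_eqI) (simp add: blinfun.scaleR_left blinfun.scaleR_right AC)
    from S(3)[OF this] have SC: "S (C x) = C (S x)" for x by (metis blinfun_apply_blinfun_compose)
    show "(sqrt c *\<^sub>R S) o\<^sub>L C = C o\<^sub>L (sqrt c *\<^sub>R S)"
      by (rule blinfun_eqI) (simp add: blinfun.scaleR_left blinfun.scaleR_right SC)
  qed
qed

text \<open>Any root \<open>U\<close> commutes with its own square, hence with the constructed root
  \<open>Q\<close>. So \<open>(Q + U) (Q - U) = 0\<close>, and by positivity
  \<open>d = Q x - U x\<close> lies in both kernels. By symmetry \<open>d\<close> is then orthogonal
  to \<open>Q x\<close> and to \<open>U x\<close>, hence to itself.\<close>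

lemma posop_sqrt_unique:
  fixes S T :: "'a::{real_inner,banach} \<Rightarrow>\<^sub>L 'a"
  assumes S: "posop S" and T: "posop T" and eq: "S o\<^sub>L S = T o\<^sub>L T"
  shows "S = T"
proof -
  obtain Q :: "'a \<Rightarrow>\<^sub>L 'a" where Q: "posop Q" "Q o\<^sub>L Q = S o\<^sub>L S"
      "\<And>C. (S o\<^sub>L S) o\<^sub>L C = C o\<^sub>L (S o\<^sub>L S) \<Longrightarrow> Q o\<^sub>L C = C o\<^sub>L Q"
    by (rule posop_sqrt[OF posop_square[OF S]]) (rule that)
  have "U = Q" if U: "posop U" "U o\<^sub>L U = S o\<^sub>L S" for U
  proof (rule blinfun_eqI)
    fix x
    have "(U o\<^sub>L U) o\<^sub>L U = U o\<^sub>L (U o\<^sub>L U)" by (rule blinfun_eqI) simp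
    then have UQ: "Q (U z) = U (Q z)" for z
      using Q(3)[of U] U(2) by (metis blinfun_apply_blinfun_compose)
    have sq: "Q (Q z) = U (U z)" for z using Q(2) U(2) by (metis blinfun_apply_blinfun_compose)
    define d where "d = Q x - U x"
    have "Q d + U d = 0" unfolding d_def by (simp add: blinfun.diff_right sq UQ)
    then have "Q d \<bullet> d + U d \<bullet> d = 0" by (metis inner_add_left inner_zero_left)
    with posop_nonneg[OF Q(1), of d] posop_nonneg[OF U(1), of d]
    have "Q d = 0" "U d = 0"
      by (auto intro!: posop_form_eq_0 Q(1) U(1))
    then have "d \<bullet> Q x = 0" "d \<bullet> U x = 0"
      using posop_sym[OF Q(1), of d x] posop_sym[OF U(1), of d x] by simp_all
    then have "d \<bullet> (Q x - U x) = 0" by (simp add: inner_diff_right)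
    then have "d \<bullet> d = 0" by (simp add: d_def)
    then show "U x = Q x" by (simp add: d_def)
  qed
  from this[of S] this[of T] eq S T show ?thesis by simp
qed

text \<open>Here \<open>J'\<close> is the adjoint of \<open>J\<close>. The left-hand side minimises
  only over vectors \<open>J f\<close>, so one inequality is immediate. For the other,
  \<open>Q\<close> and \<open>R\<close> do not see the part of \<open>u\<close> removed by
  \<open>P\<close>, and what remains is approximated from the range of \<open>J\<close>.\<close>

lemma par_congruence:
  fixes J :: "'a::{real_inner,banach} \<Rightarrow>\<^sub>L 'b::{real_inner,banach}" and J' :: "'b \<Rightarrow>\<^sub>L 'a"
    and P Q R :: "'b \<Rightarrow>\<^sub>L 'b"
  assumes adj: "\<And>x u. J x \<bullet> u = x \<bullet> J' u"
    and Q: "posop Q" and R: "posop R"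
    and PJ: "\<And>x. P (J x) = J x" and dense: "\<And>u. \<exists>g. (\<lambda>n::nat. J (g n)) \<longlonglongrightarrow> P u"
    and QP: "\<And>u. Q (P u) = Q u" and RP: "\<And>u. R (P u) = R u"
  shows "par (J' o\<^sub>L Q o\<^sub>L J) (J' o\<^sub>L R o\<^sub>L J) = J' o\<^sub>L par Q R o\<^sub>L J"
proof -
  have form: "(J' o\<^sub>L U o\<^sub>L J) x \<bullet> x = U (J x) \<bullet> J x" for U x
    by (simp add: adj[symmetric] inner_commute[of "J' _"]) (simp add: adj inner_commute)
  have pos: "posop (J' o\<^sub>L U o\<^sub>L J)" if "posop U" for U
    unfolding posop_def form
  proof (intro conjI allI posop_nonneg[OF that])
    show "(J' o\<^sub>L U o\<^sub>L J) x \<bullet> y = x \<bullet> (J' o\<^sub>L U o\<^sub>L J) y" for x y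
      using posop_sym[OF that, of "J x" "J y"] by (simp add: adj[symmetric] inner_commute)
  qed
  have Pform: "U (P u) \<bullet> P u = U u \<bullet> u" if "posop U" "\<And>u. U (P u) = U u" for U u
    using that by (metis posop_sym)
  show ?thesis
  proof (rule posop_eqI)
    show "posop (par (J' o\<^sub>L Q o\<^sub>L J) (J' o\<^sub>L R o\<^sub>L J))" by (intro par_pos pos Q R)
    show "posop (J' o\<^sub>L par Q R o\<^sub>L J)" by (intro par_pos pos Q R)
    fix h
    show "par (J' o\<^sub>L Q o\<^sub>L J) (J' o\<^sub>L R o\<^sub>L J) h \<bullet> h = (J' o\<^sub>L par Q R o\<^sub>L J) h \<bullet> h"
      unfolding form
    proof (rule antisym)
      show "par Q R (J h) \<bullet> J h \<le> par (J' o\<^sub>L Q o\<^sub>L J) (J' o\<^sub>L R o\<^sub>L J) h \<bullet> h"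
      proof (intro par_greatest pos Q R)
        fix f
        show "par Q R (J h) \<bullet> J h
            \<le> (J' o\<^sub>L Q o\<^sub>L J) f \<bullet> f + (J' o\<^sub>L R o\<^sub>L J) (h - f) \<bullet> (h - f)"
          unfolding form using par_le[OF Q R, of "J h" "J f"] by (simp only: blinfun.diff_right[of J])
      qed
      show "par (J' o\<^sub>L Q o\<^sub>L J) (J' o\<^sub>L R o\<^sub>L J) h \<bullet> h \<le> par Q R (J h) \<bullet> J h" (is "?c \<le> _")
      proof (rule par_greatest[OF Q R])
        fix u
        obtain g where g: "(\<lambda>n::nat. J (g n)) \<longlonglongrightarrow> P u" using dense by blast
        have "?c \<le> Q (J (g n)) \<bullet> J (g n) + R (J h - J (g n)) \<bullet> (J h - J (g n))" for n
          using par_le[OF pos[OF Q] pos[OF R], of h "g n"] unfolding form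
          by (simp only: blinfun.diff_right[of J])
        moreover have "(\<lambda>n. Q (J (g n)) \<bullet> J (g n) + R (J h - J (g n)) \<bullet> (J h - J (g n)))
            \<longlonglongrightarrow> Q (P u) \<bullet> P u + R (J h - P u) \<bullet> (J h - P u)"
          by (intro tendsto_intros g)
        ultimately have "?c \<le> Q (P u) \<bullet> P u + R (J h - P u) \<bullet> (J h - P u)"
          by (intro LIMSEQ_le_const) auto
        also have "J h - P u = P (J h - u)" by (simp add: blinfun.diff_right PJ)
        finally show "?c \<le> Q u \<bullet> u + R (J h - u) \<bullet> (J h - u)"
          by (simp only: Pform[OF Q QP] Pform[OF R RP])
      qed
    qed
  qed
qed

text \<open>The projection onto the closure of the range of \<open>J\<close> is the limit of \<open>J (J' J + \<epsilon>)\<^sup>-\<^sup>1 J'\<close>.\<close>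

lemma range_projection:
  fixes J :: "'a::{real_inner,banach} \<Rightarrow>\<^sub>L 'b::{real_inner,banach}" and J' :: "'b \<Rightarrow>\<^sub>L 'a"
  assumes adj: "\<And>x u. J x \<bullet> u = x \<bullet> J' u"
  obtains P :: "'b \<Rightarrow>\<^sub>L 'b" where "posop P" "\<And>x. P (J x) = J x"
    "\<And>u. \<exists>g. (\<lambda>n::nat. J (g n)) \<longlonglongrightarrow> P u" "\<And>u. P (P u) = P u"
proof -
  let ?e = "\<lambda>n. 1 / real (Suc n)"
  define B where "B = J' o\<^sub>L J"
  have Bf: "B x \<bullet> y = J x \<bullet> J y" for x y
    using adj[of y "J x"] by (simp add: B_def inner_commute)
  have B: "posop B" unfolding posop_def by (metis Bf inner_commute inner_ge_zero)
  define R where "R n = resolvent B n" for n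
  note R = resolvent[OF B, folded R_def]
  \<comment> \<open>Variational form of the resolvent: \<open>R n v \<bullet> v\<close> is the
    maximum over \<open>f\<close> of the left-hand expression, attained at \<open>f = R n v\<close>.
    A smaller regularisation gives a larger maximum, which makes \<open>D n\<close>
    increase.\<close>
  have R_ge: "2 * (v \<bullet> f) - B f \<bullet> f - ?e n * (norm f)\<^sup>2 \<le> R n v \<bullet> v"
    and R_eq: "R n v \<bullet> v = 2 * (v \<bullet> R n v) - B (R n v) \<bullet> R n v - ?e n * (norm (R n v))\<^sup>2" for n v f
  proof -
    let ?C = "B + ?e n *\<^sub>R id_blinfun"
    have C: "posop ?C" by (intro posop_add B posop_scaleR posop_id) simp
    have CR: "?C (R n v) = v"
      using R(2)[of n v] by (simp add: blinfun.add_left blinfun.scaleR_left)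
    have Cf: "?C f \<bullet> f = B f \<bullet> f + ?e n * (norm f)\<^sup>2" for f
      by (simp add: blinfun.add_left blinfun.scaleR_left inner_add_left power2_norm_eq_inner)
    have "0 \<le> ?C (R n v - f) \<bullet> (R n v - f)" by (rule posop_nonneg[OF C])
    also have "\<dots> = R n v \<bullet> v - 2 * (v \<bullet> f) + ?C f \<bullet> f"
      unfolding posop_form_diff[OF C] CR by (simp add: inner_commute)
    finally show "2 * (v \<bullet> f) - B f \<bullet> f - ?e n * (norm f)\<^sup>2 \<le> R n v \<bullet> v" unfolding Cf by simp
    have "?C (R n v) \<bullet> R n v = v \<bullet> R n v" by (simp only: CR)
    then show "R n v \<bullet> v = 2 * (v \<bullet> R n v) - B (R n v) \<bullet> R n v - ?e n * (norm (R n v))\<^sup>2"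
      unfolding Cf by (simp add: inner_commute)
  qed
  define D where "D n = J o\<^sub>L R n o\<^sub>L J'" for n
  have Df: "D n u \<bullet> w = R n (J' u) \<bullet> J' w" for n u w by (simp add: D_def adj)
  have Dpos: "posop (D n)" for n
    unfolding posop_def
  proof (intro conjI allI)
    fix u w
    show "D n u \<bullet> w = u \<bullet> D n w"
      using posop_swap[OF R(1), of n "J' u" "J' w"] by (simp add: Df inner_commute[of u])
    show "0 \<le> D n u \<bullet> u" unfolding Df by (rule posop_nonneg[OF R(1)])
  qed
  have Dinc: "D n u \<bullet> u \<le> D (Suc n) u \<bullet> u" for n u
  proof -
    let ?f = "R n (J' u)"
    have "?e (Suc n) * (norm ?f)\<^sup>2 \<le> ?e n * (norm ?f)\<^sup>2"
      by (intro mult_right_mono) (auto simp: frac_le)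
    then show ?thesis
      using R_ge[of "J' u" ?f "Suc n"] R_eq[of n "J' u"] unfolding Df by linarith
  qed
  have Dle: "D n u \<bullet> u \<le> id_blinfun u \<bullet> u" for n u
  proof -
    let ?f = "R n (J' u)"
    have "u \<bullet> J ?f = J' u \<bullet> ?f" using adj[of ?f u] by (simp only: inner_commute)
    have "0 \<le> (u - J ?f) \<bullet> (u - J ?f)" by simp
    also have "\<dots> = u \<bullet> u - 2 * (u \<bullet> J ?f) + J ?f \<bullet> J ?f"
      by (simp add: inner_diff_left inner_diff_right inner_commute)
    also have "\<dots> = u \<bullet> u - 2 * (J' u \<bullet> ?f) + B ?f \<bullet> ?f"
      unfolding Bf \<open>u \<bullet> J ?f = J' u \<bullet> ?f\<close> ..
    finally have "2 * (J' u \<bullet> ?f) - B ?f \<bullet> ?f \<le> u \<bullet> u" by simp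
    moreover have "0 \<le> ?e n * (norm ?f)\<^sup>2" by simp
    ultimately show ?thesis using R_eq[of n "J' u"] unfolding Df blinfun_apply_id_blinfun by linarith
  qed
  obtain P :: "'b \<Rightarrow>\<^sub>L 'b" where P: "posop P" "\<And>u. (\<lambda>n. D n u) \<longlonglongrightarrow> P u"
      "\<And>n u. D n u \<bullet> u \<le> P u \<bullet> u" "\<And>u. P u \<bullet> u \<le> id_blinfun u \<bullet> u"
    by (rule posop_incseq_convergent[of D, OF Dpos Dinc posop_id Dle]) (rule that)
  have PJ: "P (J x) = J x" for x
  proof -
    \<comment> \<open>Taking \<open>f = x\<close> and \<open>v = J' (J x)\<close> in
      \<open>R_ge\<close> bounds the form of \<open>P\<close> at \<open>J x\<close> from below by
      \<open>B x \<bullet> x\<close>, that is, by the square of the norm of \<open>J x\<close>, up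
      to a vanishing term. Since \<open>P\<close> is at most the identity, \<open>J x\<close> must
      be fixed.\<close>
    have "B x \<bullet> x - ?e n * (norm x)\<^sup>2 \<le> P (J x) \<bullet> J x" for n
    proof -
      have "J' (J x) = B x" by (simp add: B_def)
      then have "B x \<bullet> x - ?e n * (norm x)\<^sup>2 \<le> D n (J x) \<bullet> J x"
        using R_ge[of "B x" x n] unfolding Df by simp
      then show ?thesis using P(3) order_trans by blast
    qed
    moreover have "(\<lambda>n. B x \<bullet> x - ?e n * (norm x)\<^sup>2) \<longlonglongrightarrow> B x \<bullet> x - 0 * (norm x)\<^sup>2"
      by (intro tendsto_intros LIMSEQ_Suc[OF lim_1_over_n])
    ultimately have "B x \<bullet> x \<le> P (J x) \<bullet> J x" by (intro LIMSEQ_le_const2) auto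
    then have le: "(id_blinfun - P) (J x) \<bullet> J x \<le> 0"
      by (simp add: Bf blinfun.diff_left inner_diff_left)
    have "posop (id_blinfun - P)" using P(4) posop_diff_iff[OF P(1) posop_id] by blast
    from posop_form_eq_0[OF this le] show ?thesis by (simp add: blinfun.diff_left)
  qed
  have dense: "\<exists>g. (\<lambda>n::nat. J (g n)) \<longlonglongrightarrow> P u" for u
    using P(2)[of u] by (intro exI[of _ "\<lambda>n. R n (J' u)"]) (simp add: D_def)
  show thesis
  proof (rule that[OF P(1) PJ dense])
    fix u
    obtain g where g: "(\<lambda>n::nat. J (g n)) \<longlonglongrightarrow> P u" using dense by blast
    then have "(\<lambda>n. P (J (g n))) \<longlonglongrightarrow> P (P u)" by (intro tendsto_intros)
    then show "P (P u) = P u" using g LIMSEQ_unique unfolding PJ by blast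
  qed
qed

text \<open>Commutativity lets \<open>A (B h)\<close> be split as
  \<open>B (A (h - g n)) + A (B (g n))\<close>, and both terms tend to \<open>0\<close> along the
  sequence witnessing the vanishing parallel sum.\<close>

lemma commuting_par_eq_0:
  fixes A B :: "'a::{real_inner,banach} \<Rightarrow>\<^sub>L 'a"
  assumes A: "posop A" and B: "posop B" and AB: "\<And>x. A (B x) = B (A x)" and par: "par A B = 0"
  shows "A (B h) = 0"
proof -
  obtain g where g: "(\<lambda>n::nat. A (h - g n) \<bullet> (h - g n)) \<longlonglongrightarrow> 0" "(\<lambda>n. B (g n) \<bullet> g n) \<longlonglongrightarrow> 0"
    by (rule par_zero_sequence[OF A B, of h]) (simp add: par)
  have "(\<lambda>n. B (A (h - g n)) + A (B (g n))) \<longlonglongrightarrow> B 0 + A 0"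
    by (intro tendsto_intros posop_form_tendsto_0[OF A g(1)] posop_form_tendsto_0[OF B g(2)])
  moreover have "B (A (h - g n)) + A (B (g n)) = A (B h)" for n
    by (simp add: AB blinfun.diff_right)
  ultimately show ?thesis by (simp add: LIMSEQ_const_iff)
qed

section \<open>The iteration and its limit\<close>

text \<open>The iteration of \<open>mu\<close>, with \<open>par\<close> for
  \<open>parallel_sum\<close> so that it also makes sense on the real product space.\<close>

definition par_iter :: "('a::real_inner \<Rightarrow>\<^sub>L 'a) \<Rightarrow> ('a \<Rightarrow>\<^sub>L 'a) \<Rightarrow> nat \<Rightarrow> 'a \<Rightarrow>\<^sub>L 'a" where
  "par_iter G X n = ((\<lambda>Z. Z - par Z G) ^^ n) X"

lemma par_iter_0 [simp]: "par_iter G X 0 = X"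
  and par_iter_Suc: "par_iter G X (Suc n) = par_iter G X n - par (par_iter G X n) G"
  by (simp_all add: par_iter_def)

context
  fixes G X :: "'a::{real_inner,banach} \<Rightarrow>\<^sub>L 'a"
  assumes G: "posop G" and X: "posop X"
begin

lemma par_iter_pos: "posop (par_iter G X n)"
proof (induction n)
  case (Suc n)
  then show ?case
    unfolding par_iter_Suc using par_le_left[OF Suc G] by (simp add: posop_diff_iff par_pos[OF Suc G])
qed (simp add: X)

lemma par_iter_form_Suc:
  "par_iter G X (Suc n) x \<bullet> x = par_iter G X n x \<bullet> x - par (par_iter G X n) G x \<bullet> x"
  by (simp add: par_iter_Suc blinfun.diff_left inner_diff_left)

lemma par_iter_dec: "par_iter G X (Suc n) x \<bullet> x \<le> par_iter G X n x \<bullet> x"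
  unfolding par_iter_form_Suc using posop_nonneg[OF par_pos[OF par_iter_pos G]] by simp

lemma par_iter_le: "par_iter G X n x \<bullet> x \<le> X x \<bullet> x"
  using par_iter_dec by (induction n) (auto intro: order_trans)

lemma par_iter_ge: "X x \<bullet> x - real n * (G x \<bullet> x) \<le> par_iter G X n x \<bullet> x"
proof (induction n)
  case (Suc n)
  then show ?case
    unfolding par_iter_form_Suc using par_le_right[OF par_iter_pos G, of n x] by (simp add: algebra_simps)
qed simp

lemma par_iter_commute:
  assumes "G o\<^sub>L C = C o\<^sub>L G" "X o\<^sub>L C = C o\<^sub>L X"
  shows "par_iter G X n o\<^sub>L C = C o\<^sub>L par_iter G X n"
proof (induction n)
  case (Suc n)
  note par_commute[OF par_iter_pos G Suc assms(1)]
  with Suc have "par_iter G X n (C x) = C (par_iter G X n x)"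
    "par (par_iter G X n) G (C x) = C (par (par_iter G X n) G x)" for x
    by (metis blinfun_apply_blinfun_compose)+
  then show ?case
    unfolding par_iter_Suc by (intro blinfun_eqI) (simp add: blinfun.diff_left blinfun.diff_right)
qed (simp add: assms)

lemma par_iter_limit:
  obtains T :: "'a \<Rightarrow>\<^sub>L 'a" where "posop T" "\<And>x. (\<lambda>n. par_iter G X n x) \<longlonglongrightarrow> T x"
    "\<And>n x. T x \<bullet> x \<le> par_iter G X n x \<bullet> x"
  by (rule posop_decseq_convergent[of "par_iter G X", OF par_iter_pos par_iter_dec]) (rule that)

text \<open>As \<open>T\<close> lies below every iterate, the parallel sum of \<open>T\<close> and
  \<open>G\<close> lies below the difference of any two consecutive iterates; these differences tend
  to \<open>0\<close>.\<close>

lemma par_iter_limit_par: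
  fixes T :: "'a \<Rightarrow>\<^sub>L 'a"
  assumes T: "posop T" and lim: "\<And>x. (\<lambda>n. par_iter G X n x) \<longlonglongrightarrow> T x"
    and le: "\<And>n x. T x \<bullet> x \<le> par_iter G X n x \<bullet> x"
  shows "par T G = 0"
proof (rule blinfun_eqI)
  fix h
  have form: "(\<lambda>n. par_iter G X n h \<bullet> h) \<longlonglongrightarrow> T h \<bullet> h" by (intro tendsto_intros lim)
  have "par T G h \<bullet> h \<le> par_iter G X n h \<bullet> h - par_iter G X (Suc n) h \<bullet> h" for n
  proof -
    have "par T G h \<bullet> h \<le> par (par_iter G X n) G h \<bullet> h"
    proof (rule par_greatest[OF par_iter_pos G])
      fix f
      show "par T G h \<bullet> h \<le> par_iter G X n f \<bullet> f + G (h - f) \<bullet> (h - f)"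
        using par_le[OF T G, of h f] le[of f n] by linarith
    qed
    then show ?thesis by (simp add: par_iter_form_Suc)
  qed
  moreover have "(\<lambda>n. par_iter G X n h \<bullet> h - par_iter G X (Suc n) h \<bullet> h) \<longlonglongrightarrow> T h \<bullet> h - T h \<bullet> h"
    by (intro tendsto_intros form LIMSEQ_Suc[OF form])
  ultimately have "par T G h \<bullet> h \<le> T h \<bullet> h - T h \<bullet> h" by (intro LIMSEQ_le_const) auto
  then have "par T G h = 0" by (intro posop_form_eq_0 par_pos T G) simp
  then show "par T G h = (0 :: 'a \<Rightarrow>\<^sub>L 'a) h" by simp
qed

end

text \<open>
  Mutual singularity of the limit \<open>T\<close> and \<open>X + G - T\<close>: with \<open>J h = (X\<^sup>1\<^sup>/\<^sup>2 h, G\<^sup>1\<^sup>/\<^sup>2 h)\<close> one has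
  \<open>X = J' K J\<close> and \<open>G = J' L J\<close> for commuting \<open>K\<close>, \<open>L\<close> with \<open>K + L\<close> the projection onto the
  closure of the range of \<open>J\<close>. The iteration is transported to \<open>K\<close>, where its limit \<open>R\<close> commutes
  with \<open>L\<close>, so that \<open>R L = 0\<close> and \<open>R\<close> is a projection.
\<close>

lemma par_iter_limit_singular:
  fixes G X T :: "'a::{real_inner,banach} \<Rightarrow>\<^sub>L 'a"
  assumes G: "posop G" and X: "posop X" and lim: "\<And>x. (\<lambda>n. par_iter G X n x) \<longlonglongrightarrow> T x"
  obtains g where "(\<lambda>n::nat. T (h - g n) \<bullet> (h - g n)) \<longlonglongrightarrow> 0"
    "(\<lambda>n. (X + G - T) (g n) \<bullet> g n) \<longlonglongrightarrow> 0"
proof -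
  obtain Z :: "'a \<Rightarrow>\<^sub>L 'a" where Z: "posop Z" "Z o\<^sub>L Z = X"
    by (rule posop_sqrt[OF X])
  obtain V :: "'a \<Rightarrow>\<^sub>L 'a" where V: "posop V" "V o\<^sub>L V = G"
    by (rule posop_sqrt[OF G])
  have ZZ: "Z (Z x) = X x" and VV: "V (V x) = G x" for x
    using Z(2) V(2) by (metis blinfun_apply_blinfun_compose)+
  define J :: "'a \<Rightarrow>\<^sub>L ('a \<times> 'a)" where "J = Blinfun (\<lambda>x. (Z x, V x))"
  define J' :: "('a \<times> 'a) \<Rightarrow>\<^sub>L 'a" where "J' = (Z o\<^sub>L fst_blinfun) + (V o\<^sub>L snd_blinfun)"
  define E :: "('a \<times> 'a) \<Rightarrow>\<^sub>L ('a \<times> 'a)" where "E = Blinfun (\<lambda>u. (fst u, 0))"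
  have J: "J x = (Z x, V x)" for x
    unfolding J_def by (intro fun_cong[OF bounded_linear_Blinfun_apply] bounded_linear_intros)
  have E: "E u = (fst u, 0)" for u
    unfolding E_def by (intro fun_cong[OF bounded_linear_Blinfun_apply] bounded_linear_intros)
  have J': "J' u = Z (fst u) + V (snd u)" for u
    by (simp add: J'_def blinfun.add_left)
  have adj: "J x \<bullet> u = x \<bullet> J' u" for x u
    by (cases u) (simp add: J J' inner_add_right posop_sym[OF Z(1)] posop_sym[OF V(1)])
  obtain P :: "('a \<times> 'a) \<Rightarrow>\<^sub>L ('a \<times> 'a)" where P: "posop P" "\<And>x. P (J x) = J x"
      "\<And>u. \<exists>g. (\<lambda>n::nat. J (g n)) \<longlonglongrightarrow> P u" "\<And>u. P (P u) = P u"
    by (rule range_projection[of J J', OF adj]) (rule that)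
  \<comment> \<open>The adjoint of \<open>P (J x) = J x\<close>.\<close>
  have J'P: "J' (P u) = J' u" for u
  proof -
    have "x \<bullet> J' (P u) = x \<bullet> J' u" for x
      using posop_sym[OF P(1), of "J x" u] by (simp add: P(2) adj)
    then have "(J' (P u) - J' u) \<bullet> (J' (P u) - J' u) = 0" by (simp add: inner_diff_right)
    then show ?thesis by simp
  qed
  \<comment> \<open>\<open>K\<close> compresses the coordinate projection \<open>E\<close> to the
    range of \<open>P\<close>. There \<open>P\<close> acts as the identity, so \<open>K\<close> and
    \<open>P - K\<close> commute whatever \<open>X\<close> and \<open>G\<close> are.\<close>
  define K where "K = P o\<^sub>L E o\<^sub>L P"
  define L where "L = P - K"
  have Kf: "K u \<bullet> w = fst (P u) \<bullet> fst (P w)" for u w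
    using posop_sym[OF P(1), of "E (P u)" w] by (cases "P w") (simp add: K_def E)
  have K: "posop K" unfolding posop_def using Kf by (metis inner_commute inner_ge_zero)
  have L: "posop L"
    unfolding L_def
  proof (subst posop_diff_iff[OF K P(1)], rule allI)
    fix u
    have "P u \<bullet> u = P u \<bullet> P u" using posop_sym[OF P(1), of "P u" u] by (simp add: P(4))
    then show "K u \<bullet> u \<le> P u \<bullet> u" unfolding Kf by (simp only:) (simp add: inner_prod_def)
  qed
  have KP: "K (P u) = K u" and PK: "P (K u) = K u" for u by (simp_all add: K_def P(4))
  have LP: "L (P u) = L u" for u by (simp add: L_def blinfun.diff_left P(4) KP)
  have KL: "K (L u) = L (K u)" for u by (simp add: L_def blinfun.diff_left blinfun.diff_right KP PK)
  have J'KJ: "J' o\<^sub>L K o\<^sub>L J = X"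
    by (rule blinfun_eqI) (simp add: K_def P(2) J'P, simp add: J J' E ZZ)
  have J'LJ: "J' o\<^sub>L L o\<^sub>L J = G"
  proof (rule blinfun_eqI)
    fix x
    have "J' (K (J x)) = X x" using J'KJ by (metis blinfun_apply_blinfun_compose)
    moreover have "J' (J x) = X x + G x" by (simp add: J J' ZZ VV)
    ultimately show "(J' o\<^sub>L L o\<^sub>L J) x = G x"
      by (simp add: L_def blinfun.diff_left blinfun.diff_right P(2))
  qed
  define Q where "Q = par_iter L K"
  note Qpos = par_iter_pos[OF L K, folded Q_def]
  have QP: "Q n (P u) = Q n u" for n u
  proof -
    \<comment> \<open>The iterates stay below \<open>K\<close>, and \<open>K\<close> annihilates
      \<open>u - P u\<close>.\<close>
    have "Q n (u - P u) = 0"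
      by (rule posop_kernel_mono[OF Qpos, of _ 1 K])
        (use par_iter_le[OF L K, folded Q_def] in \<open>simp_all add: blinfun.diff_right KP\<close>)
    then show ?thesis by (simp add: blinfun.diff_right)
  qed
  have iter: "par_iter G X n = J' o\<^sub>L Q n o\<^sub>L J" for n
  proof (induction n)
    case 0
    show ?case by (simp add: Q_def J'KJ)
  next
    case (Suc n)
    have "par (par_iter G X n) G = J' o\<^sub>L par (Q n) L o\<^sub>L J"
      using par_congruence[of J J' "Q n" L P, OF adj Qpos L P(2,3) QP LP] by (simp only: Suc J'LJ)
    moreover have "Q (Suc n) = Q n - par (Q n) L" by (simp add: Q_def par_iter_Suc)
    ultimately show ?case
      unfolding par_iter_Suc Suc by (intro blinfun_eqI) (simp add: blinfun.diff_left blinfun.diff_right)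
  qed
  obtain R :: "('a \<times> 'a) \<Rightarrow>\<^sub>L ('a \<times> 'a)" where R: "posop R" "\<And>u. (\<lambda>n. Q n u) \<longlonglongrightarrow> R u" "\<And>n u. R u \<bullet> u \<le> Q n u \<bullet> u"
    by (rule par_iter_limit[OF L K, folded Q_def]) (rule that)
  have T: "T x = J' (R (J x))" for x
  proof (rule LIMSEQ_unique[OF lim])
    show "(\<lambda>n. par_iter G X n x) \<longlonglongrightarrow> J' (R (J x))"
      unfolding iter by (simp, intro tendsto_intros R(2))
  qed
  have RP: "R (P u) = R u" for u
    using R(2)[of "P u"] R(2)[of u] LIMSEQ_unique unfolding QP by blast
  have PR: "P (R u) = R u" for u
  proof -
    have "P (R u) \<bullet> w = R u \<bullet> w" for w
      by (metis posop_sym P(1) R(1) RP)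
    then have "(P (R u) - R u) \<bullet> (P (R u) - R u) = 0" by (simp add: inner_diff_left)
    then show ?thesis by simp
  qed
  have QL: "Q n (L u) = L (Q n u)" for n u
  proof -
    have "K o\<^sub>L L = L o\<^sub>L K" by (rule blinfun_eqI) (simp add: KL)
    from par_iter_commute[OF L K refl this, folded Q_def] show ?thesis
      by (metis blinfun_apply_blinfun_compose)
  qed
  have RL: "R (L u) = L (R u)" for u
  proof (rule LIMSEQ_unique[OF R(2)])
    show "(\<lambda>n. Q n (L u)) \<longlonglongrightarrow> L (R u)" unfolding QL by (intro tendsto_intros R(2))
  qed
  have "par R L = 0"
    by (rule par_iter_limit_par[OF L K R(1), folded Q_def, OF R(2,3)])
  from commuting_par_eq_0[OF R(1) L RL this] have LR0: "L (R u) = 0" for u by (simp add: RL)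
  then have KR: "K (R u) = R u" for u using LR0[of u] by (simp add: L_def blinfun.diff_left PR)
  \<comment> \<open>On the range of \<open>R\<close> the operator \<open>L\<close> vanishes, so
    \<open>K\<close> is the identity there. As \<open>K - Q n\<close> is at most \<open>n\<close>
    times \<open>L\<close>, no iterate changes these vectors, and in the limit \<open>R\<close>
    becomes idempotent.\<close>
  have QR: "Q n (R u) = R u" for n u
  proof -
    have "posop (K - Q n)"
      using par_iter_le[OF L K, folded Q_def] by (simp add: posop_diff_iff K Qpos)
    moreover have "(K - Q n) w \<bullet> w \<le> real n * (L w \<bullet> w)" for w
      using par_iter_ge[OF L K, folded Q_def, of w n] by (simp add: blinfun.diff_left inner_diff_left)
    ultimately have "(K - Q n) (R u) = 0" using LR0 by (rule posop_kernel_mono)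
    then show ?thesis by (simp add: blinfun.diff_left KR)
  qed
  have RR: "R (R u) = R u" for u
    using R(2)[of "R u"] unfolding QR by (simp add: LIMSEQ_const_iff)
  \<comment> \<open>\<open>J (g n)\<close> approximates the component of \<open>J h\<close> in the
    range of the projection \<open>R\<close>. In the limit \<open>R\<close> kills the remainder, and
    the identity minus \<open>R\<close> kills the component.\<close>
  obtain g where g: "(\<lambda>n::nat. J (g n)) \<longlonglongrightarrow> R (J h)" using P(3)[of "R (J h)"] PR by metis
  have Tf: "T x \<bullet> x = R (J x) \<bullet> J x" for x
    unfolding T using adj[of x "R (J x)"] by (simp add: inner_commute)
  have Jf: "(X + G) x \<bullet> x = J x \<bullet> J x" for x
    by (simp add: blinfun.add_left inner_add_left J flip: ZZ VV, simp add: posop_sym[OF Z(1)] posop_sym[OF V(1)])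
  show thesis
  proof (rule that[of g])
    have "(\<lambda>n. R (J h - J (g n)) \<bullet> (J h - J (g n))) \<longlonglongrightarrow> R (J h - R (J h)) \<bullet> (J h - R (J h))"
      by (intro tendsto_intros g)
    moreover have "R (J h - R (J h)) = 0" by (simp add: blinfun.diff_right RR)
    ultimately show "(\<lambda>n. T (h - g n) \<bullet> (h - g n)) \<longlonglongrightarrow> 0"
      unfolding Tf blinfun.diff_right[of J] by simp
    have "(\<lambda>n. J (g n) \<bullet> J (g n) - R (J (g n)) \<bullet> J (g n))
        \<longlonglongrightarrow> R (J h) \<bullet> R (J h) - R (R (J h)) \<bullet> R (J h)"
      by (intro tendsto_intros g)
    then show "(\<lambda>n. (X + G - T) (g n) \<bullet> g n) \<longlonglongrightarrow> 0"
      unfolding blinfun.diff_left inner_diff_left Jf Tf RR by simp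
  qed
qed

section \<open>Forms, singular parts and ranges\<close>

lemma form_dominated_tendsto_0:
  fixes U :: "'a::real_inner \<Rightarrow>\<^sub>L 'a"
  assumes U: "posop U" and le: "\<And>x. U x \<bullet> x \<le> e * q x" and q: "(\<lambda>n. q (g n)) \<longlonglongrightarrow> 0"
  shows "(\<lambda>n. U (g n) \<bullet> g n) \<longlonglongrightarrow> 0"
proof (rule real_tendsto_sandwich[of "\<lambda>_. 0"])
  show "(\<lambda>n. e * q (g n)) \<longlonglongrightarrow> 0" using tendsto_mult_left[OF q, of e] by simp
  show "(\<lambda>_. 0 :: real) \<longlonglongrightarrow> 0" by simp
qed (auto intro!: always_eventually le posop_nonneg[OF U])

lemma form_le_minus_singular_part:
  fixes S Y X G T :: "'a::{real_inner,banach} \<Rightarrow>\<^sub>L 'a"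
  assumes pos: "posop S" "posop Y" "posop G" "posop X"
    and T: "\<And>x. (\<lambda>n. par_iter G X n x) \<longlonglongrightarrow> T x"
    and le: "\<And>x. S x \<bullet> x \<le> Y x \<bullet> x + X x \<bullet> x" "\<And>x. S x \<bullet> x \<le> c * (G x \<bullet> x)" "\<And>x. Y x \<bullet> x \<le> d * (G x \<bullet> x)"
  shows "S h \<bullet> h \<le> Y h \<bullet> h + (X - T) h \<bullet> h"
proof -
  obtain L :: "'a \<Rightarrow>\<^sub>L 'a" where L: "posop L" "\<And>x. (\<lambda>n. par_iter G X n x) \<longlonglongrightarrow> L x"
    "\<And>n x. L x \<bullet> x \<le> par_iter G X n x \<bullet> x"
    by (rule par_iter_limit[OF pos(3,4)]) (rule that)
  have "L = T" by (rule blinfun_eqI) (rule LIMSEQ_unique[OF L(2) T])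
  have XT: "posop (X - T)"
    using L(3)[of _ 0] L(1) pos(4) by (simp add: posop_diff_iff \<open>L = T\<close>)
  obtain g where g: "(\<lambda>n::nat. T (h - g n) \<bullet> (h - g n)) \<longlonglongrightarrow> 0"
    "(\<lambda>n. (X + G - T) (g n) \<bullet> g n) \<longlonglongrightarrow> 0"
    by (rule par_iter_limit_singular[OF pos(3,4) T]) (rule that)
  have split: "(X + G - T) x \<bullet> x = (X - T) x \<bullet> x + G x \<bullet> x" for x
    by (simp add: blinfun.diff_left blinfun.add_left inner_diff_left inner_add_left)
  have G0: "(\<lambda>n. G (g n) \<bullet> g n) \<longlonglongrightarrow> 0"
    by (rule form_dominated_tendsto_0[OF pos(3) _ g(2), of 1])
      (use posop_nonneg[OF XT] in \<open>simp add: split\<close>)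
  have XT0: "(\<lambda>n. (X - T) (g n) \<bullet> g n) \<longlonglongrightarrow> 0"
    by (rule form_dominated_tendsto_0[OF XT _ g(2), of 1])
      (use posop_nonneg[OF pos(3)] in \<open>simp add: split\<close>)
  have dominated: "(\<lambda>n. U (g n) \<bullet> g n) \<longlonglongrightarrow> 0" if "posop U" "\<And>x. U x \<bullet> x \<le> e * (G x \<bullet> x)" for U e
    by (rule form_dominated_tendsto_0[OF that G0])
  have "S (h - g n) \<bullet> (h - g n) \<le> Y (h - g n) \<bullet> (h - g n) + (X - T) (h - g n) \<bullet> (h - g n)
      + T (h - g n) \<bullet> (h - g n)" for n
    using le(1)[of "h - g n"] by (simp add: blinfun.diff_left inner_diff_left)
  moreover have "(\<lambda>n. S (h - g n) \<bullet> (h - g n)) \<longlonglongrightarrow> S h \<bullet> h"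
    by (rule posop_form_shift_tendsto[OF pos(1) dominated[OF pos(1) le(2)]])
  moreover have "(\<lambda>n. Y (h - g n) \<bullet> (h - g n) + (X - T) (h - g n) \<bullet> (h - g n)
      + T (h - g n) \<bullet> (h - g n)) \<longlonglongrightarrow> Y h \<bullet> h + (X - T) h \<bullet> h + 0"
    by (intro tendsto_add g(1) posop_form_shift_tendsto[OF XT XT0]
        posop_form_shift_tendsto[OF pos(2) dominated[OF pos(2) le(3)]])
  ultimately show ?thesis using LIMSEQ_le by fastforce
qed

text \<open>\<open>a / (a + 1)\<close> times \<open>D\<close> is the parallel sum of
  \<open>a\<close> times \<open>D\<close> with \<open>D\<close>. The difference of the two sides is
  a multiple of the form of \<open>D\<close> at \<open>a f - (h - f)\<close>, which vanishes at the
  minimiser \<open>f = h / (a + 1)\<close>.\<close>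

lemma weighted_form_le:
  assumes D: "posop D" and a: "a \<ge> 0"
  shows "a / (a + 1) * (D h \<bullet> h) \<le> a * (D f \<bullet> f) + D (h - f) \<bullet> (h - f)"
proof -
  define w where "w = h - f"
  have h: "h = f + w" by (simp add: w_def)
  have "0 \<le> D (a *\<^sub>R f - w) \<bullet> (a *\<^sub>R f - w)" by (rule posop_nonneg[OF D])
  also have "\<dots> = a\<^sup>2 * (D f \<bullet> f) - 2 * a * (D f \<bullet> w) + D w \<bullet> w"
    unfolding posop_form_diff[OF D] by (simp add: blinfun.scaleR_right power2_eq_square)
  finally have "a * (D h \<bullet> h) \<le> (a + 1) * (a * (D f \<bullet> f) + D w \<bullet> w)"
    unfolding h posop_form_add[OF D] by (simp add: power2_eq_square algebra_simps)
  then show ?thesis using a unfolding w_def by (simp add: field_simps)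
qed

text \<open>Monotonicity of the parallel sum: \<open>n G\<close> is at least \<open>n / c\<close>
  times \<open>D\<close> and \<open>X\<close> is at least \<open>D\<close>, so their parallel sum is
  at least \<open>n / (n + c)\<close> times \<open>D\<close>. The factor tends to
  \<open>1\<close>.\<close>

lemma form_le_limit_par:
  fixes D X G L :: "'a::{real_inner,banach} \<Rightarrow>\<^sub>L 'a"
  assumes pos: "posop D" "posop G" "posop X"
    and le: "\<And>x. D x \<bullet> x \<le> X x \<bullet> x" "\<And>x. D x \<bullet> x \<le> c * (G x \<bullet> x)" and c: "c > 0"
    and L: "\<And>n x. par (real n *\<^sub>R G) X x \<bullet> x \<le> L x \<bullet> x"
  shows "D h \<bullet> h \<le> L h \<bullet> h"
proof -
  have "real n / (real n + c) * (D h \<bullet> h) \<le> L h \<bullet> h" for n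
  proof -
    let ?a = "real n / c"
    have "?a / (?a + 1) * (D h \<bullet> h) \<le> par (real n *\<^sub>R G) X h \<bullet> h"
    proof (rule par_greatest)
      fix f
      have "?a / (?a + 1) * (D h \<bullet> h) \<le> ?a * (D f \<bullet> f) + D (h - f) \<bullet> (h - f)"
        using c by (intro weighted_form_le pos) simp
      also have "\<dots> \<le> ?a * (c * (G f \<bullet> f)) + X (h - f) \<bullet> (h - f)"
        using c by (intro add_mono mult_left_mono le) auto
      also have "?a * (c * (G f \<bullet> f)) = (real n *\<^sub>R G) f \<bullet> f"
        using c by (simp add: blinfun.scaleR_left)
      finally show "?a / (?a + 1) * (D h \<bullet> h) \<le> (real n *\<^sub>R G) f \<bullet> f + X (h - f) \<bullet> (h - f)" .
    qed (auto intro: pos posop_scaleR)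
    also have "?a / (?a + 1) = real n / (real n + c)"
      using c by (simp add: field_simps add_pos_nonneg)
    finally show ?thesis using L[of n h] by linarith
  qed
  moreover have "(\<lambda>n. real n / (real n + c) * (D h \<bullet> h)) \<longlonglongrightarrow> 1 * (D h \<bullet> h)"
  proof (intro tendsto_mult_right)
    have "filterlim (\<lambda>n. c + real n) at_infinity sequentially"
      by (intro filterlim_at_top_imp_at_infinity
          filterlim_tendsto_add_at_top[OF tendsto_const filterlim_real_sequentially])
    then have "(\<lambda>n. 1 - c / (c + real n)) \<longlonglongrightarrow> 1 - 0"
      by (intro tendsto_diff tendsto_const tendsto_divide_0[OF tendsto_const])
    moreover have "1 - c / (c + real n) = real n / (real n + c)" for n
      using c by (simp add: field_simps add_pos_nonneg)
    ultimately show "(\<lambda>n. real n / (real n + c)) \<longlonglongrightarrow> 1" by simp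
  qed
  ultimately show ?thesis by (intro LIMSEQ_le_const2[of _ "D h \<bullet> h"]) auto
qed

text \<open>One statement for all the identities: \<open>H\<close> is \<open>G\<close> or an
  operator equivalent to it up to constants, and \<open>Y\<close> is later \<open>0\<close>,
  \<open>G\<close> or \<open>G'\<close>. The upper bound is the singularity estimate, the lower
  bound compares with \<open>Y + X\<close> minus the iterates; neither limit depends on the choice
  of \<open>H\<close>.\<close>

lemma limit_par_eq:
  fixes H Y X G T :: "'a::{real_inner,banach} \<Rightarrow>\<^sub>L 'a"
  assumes pos: "posop H" "posop Y" "posop G" "posop X"
    and HG: "\<And>x. H x \<bullet> x \<le> b * (G x \<bullet> x)" and GH: "\<And>x. G x \<bullet> x \<le> c * (H x \<bullet> x)"
    and YG: "\<And>x. Y x \<bullet> x \<le> d * (G x \<bullet> x)"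
    and T: "\<And>x. (\<lambda>n. par_iter G X n x) \<longlonglongrightarrow> T x"
  shows "(\<lambda>n. par (real n *\<^sub>R H) (Y + X) x) \<longlonglongrightarrow> (Y + X - T) x"
proof -
  let ?A = "\<lambda>n. par (real n *\<^sub>R H) (Y + X)"
  have nH: "posop (real n *\<^sub>R H)" for n by (intro posop_scaleR pos) simp
  have YX: "posop (Y + X)" by (intro posop_add pos)
  have Apos: "posop (?A n)" for n by (intro par_pos nH YX)
  have Ainc: "?A n x \<bullet> x \<le> ?A (Suc n) x \<bullet> x" for n x
  proof (rule par_greatest[OF nH YX])
    fix f
    have "(real n *\<^sub>R H) f \<bullet> f \<le> (real (Suc n) *\<^sub>R H) f \<bullet> f"
      using posop_nonneg[OF pos(1), of f] by (simp add: blinfun.scaleR_left mult_right_mono)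
    then show "?A n x \<bullet> x \<le> (real (Suc n) *\<^sub>R H) f \<bullet> f + (Y + X) (x - f) \<bullet> (x - f)"
      using par_le[OF nH YX, of n x f] by linarith
  qed
  obtain L :: "'a \<Rightarrow>\<^sub>L 'a" where L: "posop L" "\<And>x. (\<lambda>n. ?A n x) \<longlonglongrightarrow> L x"
      "\<And>n x. ?A n x \<bullet> x \<le> L x \<bullet> x" "\<And>x. L x \<bullet> x \<le> (Y + X) x \<bullet> x"
    by (rule posop_incseq_convergent[of ?A, OF Apos Ainc YX par_le_right[OF nH YX]]) (rule that)
  obtain T' :: "'a \<Rightarrow>\<^sub>L 'a" where T': "posop T'" "\<And>x. (\<lambda>n. par_iter G X n x) \<longlonglongrightarrow> T' x"
    "\<And>n x. T' x \<bullet> x \<le> par_iter G X n x \<bullet> x"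
    by (rule par_iter_limit[OF pos(3,4)]) (rule that)
  have [simp]: "T' = T" by (rule blinfun_eqI) (rule LIMSEQ_unique[OF T'(2) T])
  have sum: "(Y + X - T) x \<bullet> x = Y x \<bullet> x + (X - T) x \<bullet> x" for x
    by (simp add: blinfun.diff_left blinfun.add_left inner_diff_left inner_add_left)
  have form: "(\<lambda>n. U n x \<bullet> x) \<longlonglongrightarrow> W x \<bullet> x" if "\<And>x. (\<lambda>n. U n x) \<longlonglongrightarrow> W x"
    for U :: "nat \<Rightarrow> 'a \<Rightarrow>\<^sub>L 'a" and W :: "'a \<Rightarrow>\<^sub>L 'a" and x
    by (intro tendsto_intros that)
  have "L = Y + X - T"
  proof (rule posop_eqI[OF L(1)])
    have "posop (X - T)" using T'(3)[of _ 0] T'(1) pos(4) by (simp add: posop_diff_iff)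
    from posop_add[OF pos(2) this] show "posop (Y + X - T)" by (simp add: add_diff_eq)
    fix x
    show "L x \<bullet> x = (Y + X - T) x \<bullet> x"
    proof (rule antisym)
      have "?A n x \<bullet> x \<le> (Y + X - T) x \<bullet> x" for n
        unfolding sum
      proof (rule form_le_minus_singular_part[OF Apos pos(2-4) T])
        show "?A n x \<bullet> x \<le> Y x \<bullet> x + X x \<bullet> x" for x
          using par_le_right[OF nH YX, of n x] by (simp add: blinfun.add_left inner_add_left)
        have "?A n x \<bullet> x \<le> real n * (H x \<bullet> x)" for x
          using par_le_left[OF nH YX, of n x] by (simp add: blinfun.scaleR_left)
        also have "real n * (H x \<bullet> x) \<le> real n * b * (G x \<bullet> x)" for x
          using mult_left_mono[OF HG[of x], of "real n"] by (simp add: mult.assoc)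
        finally show "?A n x \<bullet> x \<le> real n * b * (G x \<bullet> x)" for x .
      qed (rule YG)
      then show "L x \<bullet> x \<le> (Y + X - T) x \<bullet> x" by (intro LIMSEQ_le_const2[OF form[OF L(2)]]) auto
      have "(Y + X - par_iter G X n) x \<bullet> x \<le> L x \<bullet> x" for n
      proof (rule form_le_limit_par[OF _ pos(1) YX _ _ _ L(3)])
        \<comment> \<open>\<open>Y\<close> contributes \<open>d\<close>, the difference of
          \<open>X\<close> and its iterate contributes \<open>n\<close>, and \<open>c\<close>
          converts \<open>G\<close> to \<open>H\<close>. The absolute values allow for constants of
          any sign; the final \<open>1\<close> gives strict positivity.\<close>
        let ?c = "(\<bar>d\<bar> + real n) * \<bar>c\<bar> + 1"
        have XI: "posop (X - par_iter G X n)"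
          using par_iter_le[OF pos(3,4)] by (simp add: posop_diff_iff par_iter_pos pos)
        have sum: "(Y + X - par_iter G X n) x \<bullet> x = Y x \<bullet> x + (X x \<bullet> x - par_iter G X n x \<bullet> x)" for x
          by (simp add: blinfun.diff_left blinfun.add_left inner_diff_left inner_add_left)
        show "posop (Y + X - par_iter G X n)" using posop_add[OF pos(2) XI] by (simp add: add_diff_eq)
        show "(Y + X - par_iter G X n) x \<bullet> x \<le> (Y + X) x \<bullet> x" for x
          unfolding sum using posop_nonneg[OF par_iter_pos[OF pos(3,4)], of n x]
          by (simp add: blinfun.add_left inner_add_left)
        show "(Y + X - par_iter G X n) x \<bullet> x \<le> ?c * (H x \<bullet> x)" for x
        proof -
          have "d * (G x \<bullet> x) \<le> \<bar>d\<bar> * (G x \<bullet> x)"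
            by (intro mult_right_mono posop_nonneg pos) simp
          then have "(Y + X - par_iter G X n) x \<bullet> x \<le> (\<bar>d\<bar> + real n) * (G x \<bullet> x)"
            unfolding sum using YG[of x] par_iter_ge[OF pos(3,4), of x n] by (simp add: algebra_simps)
          also have "\<dots> \<le> (\<bar>d\<bar> + real n) * (\<bar>c\<bar> * (H x \<bullet> x))"
          proof (rule mult_left_mono)
            have "c * (H x \<bullet> x) \<le> \<bar>c\<bar> * (H x \<bullet> x)" by (intro mult_right_mono posop_nonneg pos) simp
            then show "G x \<bullet> x \<le> \<bar>c\<bar> * (H x \<bullet> x)" using GH[of x] by linarith
          qed simp
          also have "\<dots> \<le> ?c * (H x \<bullet> x)"
            using posop_nonneg[OF pos(1), of x] by (simp add: algebra_simps)
          finally show ?thesis .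
        qed
        show "?c > 0" by (simp add: add_nonneg_pos)
      qed
      moreover have "(\<lambda>n. (Y + X - par_iter G X n) x \<bullet> x) \<longlonglongrightarrow> (Y + X - T) x \<bullet> x"
        by (rule form) (auto simp: blinfun.diff_left intro!: tendsto_intros T)
      ultimately show "(Y + X - T) x \<bullet> x \<le> L x \<bullet> x" by (intro LIMSEQ_le_const2[of _ "(Y + X - T) x \<bullet> x"]) auto
    qed
  qed
  with L(2)[of x] show ?thesis by simp
qed

text \<open>For the converse direction, \<open>T w = 0\<close> gives \<open>(X - T) w = X w\<close>.
  Splitting the vector \<open>X w\<close> by the sequence that witnesses the vanishing parallel sum
  exhibits \<open>X w \<bullet> X w\<close> as a sum of two null sequences, so
  \<open>X w = 0\<close>.\<close>

lemma kernel_singular_part_iff: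
  fixes X T :: "'a::{real_inner,banach} \<Rightarrow>\<^sub>L 'a"
  assumes X: "posop X" and T: "posop T" and le: "\<And>x. T x \<bullet> x \<le> X x \<bullet> x"
    and sing: "\<And>h. \<exists>g. (\<lambda>n::nat. T (h - g n) \<bullet> (h - g n)) \<longlonglongrightarrow> 0 \<and> (\<lambda>n. (X - T) (g n) \<bullet> g n) \<longlonglongrightarrow> 0"
  shows "(\<forall>x. T x = 0 \<longrightarrow> x = 0) \<longleftrightarrow> (\<forall>x. X x = 0 \<longrightarrow> x = 0) \<and> par (X - T) (X o\<^sub>L X) = 0"
proof -
  let ?X2 = "X o\<^sub>L X"
  have XT: "posop (X - T)" using le by (simp add: posop_diff_iff X T)
  have X2: "posop ?X2" by (rule posop_square[OF X])
  have X2f: "?X2 x \<bullet> x = (norm (X x))\<^sup>2" for x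
    using posop_sym[OF X, of "X x" x] by (simp add: power2_norm_eq_inner)
  let ?L = "par (X - T) ?X2"
  have L: "posop ?L" by (rule par_pos[OF XT X2])
  show ?thesis
  proof (intro iffI conjI allI impI)
    assume kerT: "\<forall>x. T x = 0 \<longrightarrow> x = 0"
    show "x = 0" if "X x = 0" for x
      using posop_kernel_mono[OF T _ that, of 1] le kerT by simp
    show "?L = 0"
    proof (rule blinfun_eqI)
      fix h
      have CS: "(?L h \<bullet> f)\<^sup>2 \<le> (?L h \<bullet> h) * (?L f \<bullet> f)" for f by (rule posop_Cauchy_Schwarz[OF L])
      \<comment> \<open>Since \<open>?L\<close> is at most the square of \<open>X\<close>,
        Cauchy-Schwarz bounds \<open>?L h \<bullet> f\<close> by a constant times
        \<open>norm (X f)\<close>, which is the range criterion.\<close>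
      obtain w where w: "X w = ?L h"
      proof (rule mem_range_if_inner_le[OF X])
        fix f
        have "(?L h \<bullet> f)\<^sup>2 \<le> (?L h \<bullet> h) * (norm (X f))\<^sup>2"
          using CS[of f] mult_left_mono[OF par_le_right[OF XT X2, of f] posop_nonneg[OF L, of h]]
          unfolding X2f by linarith
        also have "\<dots> = (sqrt (?L h \<bullet> h) * norm (X f))\<^sup>2"
          using posop_nonneg[OF L] by (simp add: power_mult_distrib)
        finally show "?L h \<bullet> f \<le> sqrt (?L h \<bullet> h) * norm (X f)"
          using posop_nonneg[OF L] by (simp add: power2_le_iff_abs_le)
      qed blast
      obtain g where g: "(\<lambda>n::nat. T (w - g n) \<bullet> (w - g n)) \<longlonglongrightarrow> 0" "(\<lambda>n. (X - T) (g n) \<bullet> g n) \<longlonglongrightarrow> 0"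
        using sing by blast
      have Lg: "(\<lambda>n. ?L (g n) \<bullet> g n) \<longlonglongrightarrow> 0"
        by (rule real_tendsto_sandwich[OF _ _ tendsto_const g(2)])
          (use posop_nonneg[OF L] par_le_left[OF XT X2] in auto)
      have "(\<lambda>n. ?L (g n) \<bullet> h - (X - T) (g n) \<bullet> w + T (w - g n) \<bullet> w) \<longlonglongrightarrow> 0 \<bullet> h - 0 \<bullet> w + 0 \<bullet> w"
        by (intro tendsto_intros posop_form_tendsto_0[OF L Lg] posop_form_tendsto_0[OF XT g(2)]
            posop_form_tendsto_0[OF T g(1)])
      \<comment> \<open>By symmetry and \<open>X w = ?L h\<close> the first term equals
        \<open>X (g n) \<bullet> w\<close>, so the sum is constant in \<open>n\<close>. It also
        tends to \<open>0\<close>: the first term because \<open>?L\<close> is at most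
        \<open>X - T\<close>, the other two by the choice of \<open>g\<close>.\<close>
      moreover have "?L (g n) \<bullet> h - (X - T) (g n) \<bullet> w + T (w - g n) \<bullet> w = T w \<bullet> w" for n
        using posop_swap[OF L, of "g n" h] posop_swap[OF X, of w "g n"]
        by (simp add: w[symmetric] blinfun.diff_left blinfun.diff_right inner_diff_left)
      ultimately have "T w \<bullet> w = 0" by (simp add: LIMSEQ_const_iff)
      then have "w = 0" using posop_form_eq_0[OF T, of w] kerT by simp
      then show "?L h = (0 :: 'a \<Rightarrow>\<^sub>L 'a) h" using w by simp
    qed
  next
    fix w assume *: "(\<forall>x. X x = 0 \<longrightarrow> x = 0) \<and> ?L = 0" and Tw: "T w = 0"
    have v: "(X - T) w = X w" by (simp add: blinfun.diff_left Tw)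
    obtain g where g: "(\<lambda>n::nat. (X - T) (X w - g n) \<bullet> (X w - g n)) \<longlonglongrightarrow> 0" "(\<lambda>n. ?X2 (g n) \<bullet> g n) \<longlonglongrightarrow> 0"
      by (rule par_zero_sequence[OF XT X2, of "X w"]) (use * in simp)
    have "(\<lambda>n. (norm (X (g n)))\<^sup>2) \<longlonglongrightarrow> 0" using g(2) unfolding X2f .
    from tendsto_real_sqrt[OF this] have "(\<lambda>n. norm (X (g n))) \<longlonglongrightarrow> 0" by simp
    then have Xg: "(\<lambda>n. X (g n)) \<longlonglongrightarrow> 0" by (rule tendsto_norm_zero_cancel)
    have "(\<lambda>n. (X - T) (X w - g n) \<bullet> w + X (g n) \<bullet> w) \<longlonglongrightarrow> 0 \<bullet> w + 0 \<bullet> w"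
      by (intro tendsto_intros posop_form_tendsto_0[OF XT g(1)] Xg)
    moreover have "(X - T) (X w - g n) \<bullet> w + X (g n) \<bullet> w = X w \<bullet> X w" for n
      using posop_swap[OF XT, of "X w - g n" w] posop_swap[OF X, of "g n" w]
      by (simp only: v) (simp add: inner_diff_right)
    ultimately have "X w \<bullet> X w = 0" by (simp add: LIMSEQ_const_iff)
    then show "w = 0" using * by simp
  qed
qed

section \<open>Uniform boundedness and Douglas's range inclusion lemma\<close>

lemma uniform_boundedness_inner:
  fixes U :: "'a::{real_inner,banach} set"
  assumes "\<And>x. \<exists>c. \<forall>u\<in>U. \<bar>u \<bullet> x\<bar> \<le> c"
  obtains C where "\<And>u. u \<in> U \<Longrightarrow> norm u \<le> C"
proof -
  define F where "F n = {x. \<forall>u\<in>U. \<bar>u \<bullet> x\<bar> \<le> real n}" for n :: nat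
  have "\<Union>(range F) = UNIV"
  proof safe
    fix x
    obtain c where c: "\<forall>u\<in>U. \<bar>u \<bullet> x\<bar> \<le> c" using assms by blast
    obtain n where "c \<le> real n" using real_arch_simple by blast
    then have "x \<in> F n" unfolding F_def using c order_trans by blast
    then show "x \<in> \<Union>(range F)" by blast
  qed simp
  have closed: "closed (F n)" for n
  proof -
    have "F n = (\<Inter>u\<in>U. {x. \<bar>u \<bullet> x\<bar> \<le> real n})" by (auto simp: F_def)
    then show ?thesis by (auto intro!: closed_INT closed_Collect_le continuous_intros)
  qed
  have "\<exists>n. interior (F n) \<noteq> {}"
  proof (rule ccontr)
    assume "\<nexists>n. interior (F n) \<noteq> {}"
    then have "euclidean interior_of \<Union>(range F) = {}"
      by (intro Baire_category_alt) (auto simp: completely_metrizable_space_euclidean closed)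
    then show False using \<open>\<Union>(range F) = UNIV\<close> by simp
  qed
  then obtain n x0 where "x0 \<in> interior (F n)" by blast
  then obtain r where r: "r > 0" "cball x0 r \<subseteq> F n" by (meson mem_interior_cball)
  \<comment> \<open>\<open>x0\<close> and the point at distance \<open>r\<close> from it in the
    direction of \<open>u\<close> both lie in \<open>F n\<close>; subtracting gives
    \<open>r * norm u \<le> 2 * real n\<close>.\<close>
  show thesis
  proof (rule that[of "2 * real n / r"])
    fix u assume u: "u \<in> U"
    show "norm u \<le> 2 * real n / r"
    proof (cases "u = 0")
      case False
      let ?x = "x0 + (r / norm u) *\<^sub>R u"
      have "?x \<in> F n" "x0 \<in> F n" using r False by (auto simp: dist_norm)
      then have "\<bar>u \<bullet> ?x\<bar> \<le> real n" "\<bar>u \<bullet> x0\<bar> \<le> real n" using u by (auto simp: F_def)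
      moreover have "u \<bullet> ?x = u \<bullet> x0 + r * norm u"
        using False by (simp add: inner_add_right power2_norm_eq_inner[symmetric] power2_eq_square)
      ultimately have "r * norm u \<le> 2 * real n" by linarith
      then show ?thesis using r(1) by (simp add: field_simps)
    qed (use r in simp)
  qed
qed

text \<open>If \<open>S x = R y\<close>, then \<open>S f \<bullet> x = R f \<bullet> y\<close> is
  bounded by \<open>norm y\<close> on the set where \<open>norm (R f) \<le> 1\<close>. So the image
  of this set under \<open>S\<close> is weakly bounded, hence bounded, and homogeneity gives the
  constant.\<close>

lemma square_le_if_range_subset:
  fixes S R :: "'a::{real_inner,banach} \<Rightarrow>\<^sub>L 'a"
  assumes S: "posop S" and R: "posop R" and ran: "range S \<subseteq> range R"
  obtains c where "\<And>x. (S o\<^sub>L S) x \<bullet> x \<le> c * ((R o\<^sub>L R) x \<bullet> x)"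
proof -
  obtain C where C: "\<And>u. u \<in> S ` {f. norm (R f) \<le> 1} \<Longrightarrow> norm u \<le> C"
  proof (rule uniform_boundedness_inner[of "S ` {f. norm (R f) \<le> 1}"])
    fix x
    obtain y where y: "S x = R y" using ran by blast
    have "\<bar>S f \<bullet> x\<bar> \<le> norm y" if "norm (R f) \<le> 1" for f
    proof -
      have "S f \<bullet> x = R f \<bullet> y" using posop_sym[OF S, of f x] posop_sym[OF R, of f y] y by simp
      also have "\<bar>\<dots>\<bar> \<le> norm (R f) * norm y" by (rule Cauchy_Schwarz_ineq2)
      also have "\<dots> \<le> 1 * norm y" using that by (intro mult_right_mono) auto
      finally show ?thesis by simp
    qed
    then show "\<exists>c. \<forall>u\<in>S ` {f. norm (R f) \<le> 1}. \<bar>u \<bullet> x\<bar> \<le> c" by blast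
  qed (rule that)
  have le: "norm (S f) \<le> C * norm (R f)" for f
  proof (cases "R f = 0")
    case True
    \<comment> \<open>All multiples of a kernel vector of \<open>R\<close> lie in the set, which
      forces \<open>S f = 0\<close>.\<close>
    have "real n * norm (S f) \<le> C" for n
      using C[OF imageI, of "real n *\<^sub>R f"] True by (simp add: blinfun.scaleR_right)
    then have "norm (S f) = 0"
      by (metis norm_ge_zero not_less order_le_less reals_Archimedean3)
    then show ?thesis using True by simp
  next
    case False
    let ?f = "(1 / norm (R f)) *\<^sub>R f"
    have "norm (S ?f) \<le> C" using False by (intro C imageI) (simp add: blinfun.scaleR_right)
    then show ?thesis using False by (simp add: blinfun.scaleR_right field_simps)
  qed
  have sq: "(U o\<^sub>L U) x \<bullet> x = (norm (U x))\<^sup>2" if "posop U" for U x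
    using posop_sym[OF that, of "U x" x] by (simp add: power2_norm_eq_inner)
  show thesis
  proof (rule that)
    fix x
    have "(norm (S x))\<^sup>2 \<le> (C * norm (R x))\<^sup>2" by (intro power_mono le norm_ge_zero)
    then show "(S o\<^sub>L S) x \<bullet> x \<le> C\<^sup>2 * ((R o\<^sub>L R) x \<bullet> x)"
      unfolding sq[OF S] sq[OF R] by (simp add: power_mult_distrib)
  qed
qed

section \<open>Complex Hilbert spaces\<close>

text \<open>The imaginary part is recovered from the real inner product at \<open>\<i>\<close> times
  \<open>x\<close>. Hence a real-symmetric operator that commutes with \<open>\<i>\<close> is
  self-adjoint for \<open>cinner\<close>.\<close>

lemma cinner_eq_Complex: "cinner x y = Complex (x \<bullet> y) (- (scaleC \<i> x \<bullet> y))"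
  by (rule complex_eqI) (simp_all add: inner_eq_Re_cinner cinner_scaleC_left)

lemma bounded_linear_scaleC: "bounded_linear (scaleC c :: 'a::complex_hilbert \<Rightarrow> 'a)"
proof (rule bounded_linear_intro[of _ "cmod c"])
  fix x y :: 'a and r :: real
  show "c *\<^sub>C (x + y) = c *\<^sub>C x + c *\<^sub>C y" by (rule scaleC_add_right)
  show "c *\<^sub>C (r *\<^sub>R x) = r *\<^sub>R (c *\<^sub>C x)"
    by (simp add: scaleR_scaleC scaleC_scaleC mult.commute)
  have "cinner (c *\<^sub>C x) (c *\<^sub>C x) = c * cnj (c * cinner x x)"
    by (metis cinner_commute cinner_scaleC_left)
  also have "\<dots> = (c * cnj c) * cinner x x"
    by (simp flip: cinner_commute)
  also have "c * cnj c = complex_of_real ((cmod c)\<^sup>2)" by (rule complex_norm_square[symmetric])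
  finally have "(norm (c *\<^sub>C x))\<^sup>2 = (cmod c)\<^sup>2 * (norm x)\<^sup>2"
    by (simp add: power2_norm_eq_inner inner_eq_Re_cinner)
  then have "(norm (c *\<^sub>C x))\<^sup>2 = (norm x * cmod c)\<^sup>2" by (simp add: power_mult_distrib mult.commute)
  then show "norm (c *\<^sub>C x) \<le> norm x * cmod c" by (simp add: power2_eq_iff_nonneg)
qed

text \<open>Multiplication by a scalar as a bounded real-linear operator, so that complex linearity
  becomes a commutation relation to which the commutant clauses apply.\<close>

definition scaleC_op :: "complex \<Rightarrow> 'a::complex_hilbert \<Rightarrow>\<^sub>L 'a" where
  "scaleC_op c = Blinfun (scaleC c)"

lemma scaleC_op [simp]: "scaleC_op c x = c *\<^sub>C x"
  by (simp add: scaleC_op_def bounded_linear_Blinfun_apply bounded_linear_scaleC)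

lemma qform_eq_inner: "qform A x = A x \<bullet> x"
  by (simp add: qform_def inner_eq_Re_cinner)

lemma Bplus_iff: "A \<in> Bplus \<longleftrightarrow> posop A \<and> (\<forall>c. A o\<^sub>L scaleC_op c = scaleC_op c o\<^sub>L A)"
proof
  assume A: "A \<in> Bplus"
  then have "posop A"
    unfolding posop_def by (auto simp: Bplus_def qform_eq_inner inner_eq_Re_cinner)
  moreover have "A o\<^sub>L scaleC_op c = scaleC_op c o\<^sub>L A" for c
    using A by (intro blinfun_eqI) (simp add: Bplus_def)
  ultimately show "posop A \<and> (\<forall>c. A o\<^sub>L scaleC_op c = scaleC_op c o\<^sub>L A)" by blast
next
  assume *: "posop A \<and> (\<forall>c. A o\<^sub>L scaleC_op c = scaleC_op c o\<^sub>L A)"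
  then have lin: "A (c *\<^sub>C x) = c *\<^sub>C A x" for c x
    by (metis blinfun_apply_blinfun_compose scaleC_op)
  moreover have "cinner (A x) y = cinner x (A y)" for x y
    using * by (simp add: cinner_eq_Complex posop_sym flip: lin)
  ultimately show "A \<in> Bplus"
    using * by (simp add: Bplus_def qform_eq_inner posop_nonneg)
qed

lemma Bplus_posop: "A \<in> Bplus \<Longrightarrow> posop A"
  by (simp add: Bplus_iff)

lemma Bplus_scaleC: "A \<in> Bplus \<Longrightarrow> A (c *\<^sub>C x) = c *\<^sub>C A x"
  by (simp add: Bplus_def)

lemma BplusI:
  assumes "posop A" "\<And>c x. A (c *\<^sub>C x) = c *\<^sub>C A x"
  shows "A \<in> Bplus"
  unfolding Bplus_iff using assms by (auto intro: blinfun_eqI)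

lemma scaleC_diff_right: "c *\<^sub>C (x - y) = c *\<^sub>C x - c *\<^sub>C y"
  by (metis scaleC_add_right add_diff_cancel_right' diff_add_cancel)

lemma scaleC_zero_right: "c *\<^sub>C 0 = 0"
  by (metis scaleC_add_right add_cancel_right_right)

lemma Bplus_zero: "0 \<in> Bplus"
  by (intro BplusI) (simp_all add: scaleC_zero_right)

lemma Bplus_add: "A \<in> Bplus \<Longrightarrow> B \<in> Bplus \<Longrightarrow> A + B \<in> Bplus"
  by (intro BplusI posop_add)
    (simp_all add: Bplus_posop Bplus_scaleC blinfun.add_left scaleC_add_right)

lemma Bplus_scaleR: "A \<in> Bplus \<Longrightarrow> 0 \<le> r \<Longrightarrow> r *\<^sub>R A \<in> Bplus"
  by (intro BplusI posop_scaleR)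
    (simp_all add: Bplus_posop Bplus_scaleC blinfun.scaleR_left scaleR_scaleC scaleC_scaleC mult.commute)

lemma Bplus_diff:
  assumes "A \<in> Bplus" "B \<in> Bplus" "\<And>x. B x \<bullet> x \<le> A x \<bullet> x"
  shows "A - B \<in> Bplus"
  using assms by (intro BplusI)
    (simp_all add: posop_diff_iff Bplus_posop Bplus_scaleC blinfun.diff_left scaleC_diff_right)

lemma Bplus_square: "A \<in> Bplus \<Longrightarrow> A o\<^sub>L A \<in> Bplus"
  by (intro BplusI posop_square) (simp_all add: Bplus_posop Bplus_scaleC)

lemma Bplus_strong_limit:
  assumes A: "\<And>n. A n \<in> Bplus" and T: "strong_tendsto A T"
  shows "T \<in> Bplus"
proof (rule BplusI)
  have lim: "(\<lambda>n. A n x) \<longlonglongrightarrow> T x" for x using T by (simp add: strong_tendsto_def)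
  show "posop T" by (rule posop_limit[OF Bplus_posop[OF A] lim])
  fix c x
  have "(\<lambda>n. scaleC_op c (A n x)) \<longlonglongrightarrow> scaleC_op c (T x)" by (intro tendsto_intros lim)
  then show "T (c *\<^sub>C x) = c *\<^sub>C T x"
    using lim[of "c *\<^sub>C x"] LIMSEQ_unique unfolding Bplus_scaleC[OF A] scaleC_op by blast
qed

lemma op_le_iff:
  assumes A: "A \<in> Bplus" and B: "B \<in> Bplus"
  shows "op_le A B \<longleftrightarrow> (\<forall>x. A x \<bullet> x \<le> B x \<bullet> x)"
  using posop_diff_iff[OF Bplus_posop[OF A] Bplus_posop[OF B]] Bplus_posop[of "B - A"]
    Bplus_diff[OF B A]
  unfolding op_le_def by blast

lemma par_Bplus:
  assumes "X \<in> Bplus" "G \<in> Bplus"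
  shows "par X G \<in> Bplus"
  using assms par_pos[of X G] par_commute[of X G] unfolding Bplus_iff by blast

lemma parallel_sum_eq_par:
  assumes X: "X \<in> Bplus" and G: "G \<in> Bplus"
  shows "parallel_sum X G = par X G"
proof -
  note pos = Bplus_posop[OF X] Bplus_posop[OF G]
  have Inf: "Inf {qform X f + qform G g |f g. h = f + g} = par X G h \<bullet> h" for h
  proof (rule cInf_eq_non_empty)
    show "{qform X f + qform G g |f g. h = f + g} \<noteq> {}" by (metis (mono_tags, lifting) add_0_right empty_iff mem_Collect_eq)
    show "par X G h \<bullet> h \<le> z" if "z \<in> {qform X f + qform G g |f g. h = f + g}" for z
    proof -
      obtain f g where "z = qform X f + qform G g" "h = f + g" using \<open>z \<in> _\<close> by blast
      then show ?thesis using par_le[OF pos, of h f] by (simp add: qform_eq_inner)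
    qed
    show "c \<le> par X G h \<bullet> h"
      if c: "\<And>z. z \<in> {qform X f + qform G g |f g. h = f + g} \<Longrightarrow> c \<le> z" for c
    proof (rule par_greatest[OF pos])
      fix f
      have "h = f + (h - f)" by simp
      then have "qform X f + qform G (h - f) \<in> {qform X f + qform G g |f g. h = f + g}" by blast
      from c[OF this] show "c \<le> X f \<bullet> f + G (h - f) \<bullet> (h - f)" by (simp add: qform_eq_inner)
    qed
  qed
  show ?thesis
    unfolding parallel_sum_def Inf
  proof (rule the_equality)
    show "par X G \<in> Bplus \<and> (\<forall>h. qform (par X G) h = par X G h \<bullet> h)"
      by (simp add: par_Bplus X G qform_eq_inner)
    fix T assume "T \<in> Bplus \<and> (\<forall>h. qform T h = par X G h \<bullet> h)"
    then show "T = par X G"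
      by (intro posop_eqI[OF _ par_pos[OF pos]]) (simp_all add: Bplus_posop flip: qform_eq_inner)
  qed
qed

lemma op_sqrt:
  assumes A: "A \<in> Bplus"
  shows "op_sqrt A \<in> Bplus" "op_sqrt A o\<^sub>L op_sqrt A = A"
proof -
  obtain S where S: "posop S" "S o\<^sub>L S = A" "\<And>C. A o\<^sub>L C = C o\<^sub>L A \<Longrightarrow> S o\<^sub>L C = C o\<^sub>L S"
    by (rule posop_sqrt[OF Bplus_posop[OF A]]) (rule that)
  have SB: "S \<in> Bplus" using A S(1,3) unfolding Bplus_iff by blast
  have "op_sqrt A = S"
    unfolding op_sqrt_def
  proof (rule the_equality)
    show "S \<in> Bplus \<and> S o\<^sub>L S = A" using SB S(2) by blast
    show "S' = S" if "S' \<in> Bplus \<and> S' o\<^sub>L S' = A" for S'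
      using that S(2) by (intro posop_sqrt_unique[OF _ S(1)]) (simp_all add: Bplus_posop)
  qed
  then show "op_sqrt A \<in> Bplus" "op_sqrt A o\<^sub>L op_sqrt A = A" using SB S(2) by simp_all
qed

lemma strong_lim_eq: "strong_tendsto A T \<Longrightarrow> strong_lim A = T"
  unfolding strong_lim_def
proof (rule the_equality)
  fix U assume T: "strong_tendsto A T" and U: "strong_tendsto A U"
  show "U = T"
    using T U by (intro blinfun_eqI) (auto simp: strong_tendsto_def intro: LIMSEQ_unique)
qed

section \<open>The limit and the absolutely continuous part over complex spaces\<close>

context
  fixes G X :: "'a::complex_hilbert \<Rightarrow>\<^sub>L 'a"
  assumes G: "G \<in> Bplus" and X: "X \<in> Bplus"
begin

lemmas pos_GX = Bplus_posop[OF G] Bplus_posop[OF X]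

text \<open>Membership in \<open>Bplus\<close> is carried through the induction because the
  identification of \<open>parallel_sum\<close> with \<open>par\<close> has it as a
  hypothesis.\<close>

lemma mu_iterate: "(mu G ^^ n) X = par_iter G X n \<and> par_iter G X n \<in> Bplus"
proof (induction n)
  case (Suc n)
  then have "(mu G ^^ Suc n) X = mu G (par_iter G X n)" by simp
  also have "\<dots> = par_iter G X (Suc n)"
    using Suc by (simp add: mu_def parallel_sum_eq_par G par_iter_Suc)
  finally have "(mu G ^^ Suc n) X = par_iter G X (Suc n)" .
  moreover have "par_iter G X (Suc n) \<in> Bplus"
    unfolding par_iter_Suc using Suc
    by (intro Bplus_diff par_Bplus par_le_left) (auto simp: G Bplus_posop)
  ultimately show ?case by blast
qed (simp add: X)

lemma
  shows tau_limit: "(\<lambda>n. par_iter G X n x) \<longlonglongrightarrow> tau G X x"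
    and tau_Bplus: "tau G X \<in> Bplus"
    and tau_le_iter: "tau G X x \<bullet> x \<le> par_iter G X n x \<bullet> x"
proof -
  obtain T :: "'a \<Rightarrow>\<^sub>L 'a" where T: "posop T" "\<And>x. (\<lambda>n. par_iter G X n x) \<longlonglongrightarrow> T x"
      "\<And>n x. T x \<bullet> x \<le> par_iter G X n x \<bullet> x"
    by (rule par_iter_limit[OF pos_GX]) (rule that)
  have lim: "strong_tendsto (par_iter G X) T" using T(2) by (simp add: strong_tendsto_def)
  have "tau G X = T"
    unfolding tau_def using mu_iterate by (intro strong_lim_eq) (simp add: strong_tendsto_def T(2))
  then show "(\<lambda>n. par_iter G X n x) \<longlonglongrightarrow> tau G X x" "tau G X x \<bullet> x \<le> par_iter G X n x \<bullet> x"
    "tau G X \<in> Bplus"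
    using T Bplus_strong_limit[OF _ lim] mu_iterate by auto
qed

lemma tau_le: "tau G X x \<bullet> x \<le> X x \<bullet> x"
  using tau_le_iter[of x 0] by simp

lemma ac_part_add_eq:
  assumes H: "H \<in> Bplus" and Y: "Y \<in> Bplus"
    and HG: "\<And>x. H x \<bullet> x \<le> b * (G x \<bullet> x)" and GH: "\<And>x. G x \<bullet> x \<le> c * (H x \<bullet> x)"
    and YG: "\<And>x. Y x \<bullet> x \<le> d * (G x \<bullet> x)"
  shows "ac_part H (Y + X) = Y + X - tau G X"
  unfolding ac_part_def
proof (rule strong_lim_eq)
  have "parallel_sum (real n *\<^sub>R H) (Y + X) = par (real n *\<^sub>R H) (Y + X)" for n
    by (intro parallel_sum_eq_par Bplus_add Bplus_scaleR H Y X) simp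
  then show "strong_tendsto (\<lambda>n. parallel_sum (real n *\<^sub>R H) (Y + X)) (Y + X - tau G X)"
    unfolding strong_tendsto_def
    using limit_par_eq[OF Bplus_posop[OF H] Bplus_posop[OF Y] pos_GX HG GH YG tau_limit] by simp
qed

lemma ac_part_eq: "ac_part G X = X - tau G X"
  using ac_part_add_eq[OF G Bplus_zero, of 1 1 0] by simp

lemma ac_part_Bplus: "ac_part G X \<in> Bplus"
  unfolding ac_part_eq by (intro Bplus_diff X tau_Bplus tau_le)

text \<open>The singularity estimate with \<open>Y = 0\<close>. This is the maximality of
  \<open>[G]X\<close> among the operators below \<open>X\<close> dominated by a multiple of
  \<open>G\<close>, on which the criterion for a zero limit and subadditivity both rely.\<close>

lemma form_le_ac_part:
  assumes "D \<in> Bplus" "\<And>x. D x \<bullet> x \<le> X x \<bullet> x" "\<And>x. D x \<bullet> x \<le> c * (G x \<bullet> x)"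
  shows "D h \<bullet> h \<le> ac_part G X h \<bullet> h"
  unfolding ac_part_eq
  using form_le_minus_singular_part[OF Bplus_posop[OF assms(1)] posop_zero pos_GX tau_limit,
      where c = c and d = 0] assms by simp

text \<open>The iteration itself supplies the witness: each step removes at most \<open>G\<close>,
  so \<open>X\<close> minus the \<open>n\<close>-th iterate is at most \<open>n G\<close>, and these
  differences increase to \<open>[G]X\<close>.\<close>

lemma abs_cont_ac_part: "abs_cont G (ac_part G X)"
proof -
  let ?D = "\<lambda>n. X - par_iter G X n"
  have D: "?D n \<in> Bplus" for n
    by (intro Bplus_diff X par_iter_le pos_GX) (simp add: mu_iterate)
  have form: "?D n x \<bullet> x = X x \<bullet> x - par_iter G X n x \<bullet> x" for n x
    by (simp add: blinfun.diff_left inner_diff_left)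
  have 1: "op_le (?D n) (?D (Suc n))" for n
    unfolding op_le_iff[OF D D] form using par_iter_dec[OF pos_GX, of n] by simp
  have 2: "op_le (?D n) (real n *\<^sub>R G)" for n
    unfolding op_le_iff[OF D Bplus_scaleR[OF G of_nat_0_le_iff]] form
    using par_iter_ge[OF pos_GX, of _ n] by (simp add: blinfun.scaleR_left algebra_simps)
  have 3: "strong_tendsto ?D (ac_part G X)"
    unfolding strong_tendsto_def ac_part_eq blinfun.diff_left by (intro allI tendsto_intros tau_limit)
  show ?thesis
    unfolding abs_cont_def by (intro conjI exI[of _ ?D] allI ac_part_Bplus D 1 3, rule exI, rule 2)
qed

lemma tau_eq_0_iff: "tau G X = 0 \<longleftrightarrow> abs_cont G X"
proof
  assume "tau G X = 0"
  then show "abs_cont G X" using abs_cont_ac_part by (simp add: ac_part_eq)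
next
  assume "abs_cont G X"
  then obtain D where D: "\<And>n. D n \<in> Bplus" "\<And>n. op_le (D n) (D (Suc n))" "strong_tendsto D X"
      "\<And>n. \<exists>a. op_le (D n) (a *\<^sub>R G)"
    unfolding abs_cont_def by blast
  have form: "(\<lambda>n. D n x \<bullet> x) \<longlonglongrightarrow> X x \<bullet> x" for x
    using D(3) by (intro tendsto_inner tendsto_const) (simp add: strong_tendsto_def)
  have "incseq (\<lambda>n. D n x \<bullet> x)" for x
    using D(2) by (intro incseq_SucI) (simp add: op_le_iff D(1))
  then have DX: "D n x \<bullet> x \<le> X x \<bullet> x" for n x using form by (rule incseq_le)
  have "D n h \<bullet> h \<le> ac_part G X h \<bullet> h" for n h
  proof -
    obtain a where "op_le (D n) (a *\<^sub>R G)" using D(4) by blast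
    then have "posop (a *\<^sub>R G - D n)" unfolding op_le_def by (rule Bplus_posop)
    then have "D n x \<bullet> x \<le> a * (G x \<bullet> x)" for x
      using posop_nonneg[of "a *\<^sub>R G - D n" x]
      by (simp add: blinfun.diff_left blinfun.scaleR_left inner_diff_left)
    then show ?thesis by (rule form_le_ac_part[OF D(1) DX])
  qed
  \<comment> \<open>Every approximant lies below \<open>[G]X\<close> by maximality; in the limit so
    does \<open>X\<close>, which leaves no room for \<open>tau G X\<close>.\<close>
  then have "X h \<bullet> h \<le> ac_part G X h \<bullet> h" for h by (intro LIMSEQ_le_const2[OF form]) auto
  then have "tau G X h \<bullet> h \<le> 0" for h
    unfolding ac_part_eq by (simp add: blinfun.diff_left inner_diff_left)
  then show "tau G X = 0"
    by (intro blinfun_eqI) (simp add: posop_form_eq_0[OF Bplus_posop[OF tau_Bplus]])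
qed

lemma strong_sums_ac_part: "strong_sums (\<lambda>n. parallel_sum ((mu G ^^ n) X) G) (ac_part G X)"
proof -
  have "(\<Sum>n<N. parallel_sum ((mu G ^^ n) X) G) = X - par_iter G X N" for N
  proof (induction N)
    case (Suc N)
    then show ?case using mu_iterate[of N] by (simp add: par_iter_Suc parallel_sum_eq_par G)
  qed simp
  then show ?thesis
    unfolding strong_sums_def strong_tendsto_def ac_part_eq
    by (simp add: blinfun.diff_left tendsto_diff tau_limit)
qed

lemma tau_Bplus0_iff:
  "tau G X \<in> Bplus0 \<longleftrightarrow> X \<in> Bplus0 \<and> parallel_sum (ac_part G X) (X o\<^sub>L X) = 0"
proof -
  have "\<exists>g. (\<lambda>n::nat. tau G X (h - g n) \<bullet> (h - g n)) \<longlonglongrightarrow> 0 \<and>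
      (\<lambda>n. (X - tau G X) (g n) \<bullet> g n) \<longlonglongrightarrow> 0" for h
  proof -
    obtain g where g: "(\<lambda>n::nat. tau G X (h - g n) \<bullet> (h - g n)) \<longlonglongrightarrow> 0"
        "(\<lambda>n. (X + G - tau G X) (g n) \<bullet> g n) \<longlonglongrightarrow> 0"
      by (rule par_iter_limit_singular[OF pos_GX tau_limit])
    have "(\<lambda>n. (X - tau G X) (g n) \<bullet> g n) \<longlonglongrightarrow> 0"
    proof (rule form_dominated_tendsto_0[where e = 1 and g = g and q = "\<lambda>x. (X + G - tau G X) x \<bullet> x", OF _ _ g(2)])
      show "posop (X - tau G X)" using ac_part_Bplus unfolding ac_part_eq by (rule Bplus_posop)
      show "(X - tau G X) x \<bullet> x \<le> 1 * ((X + G - tau G X) x \<bullet> x)" for x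
        using posop_nonneg[OF pos_GX(1), of x]
        by (simp add: blinfun.diff_left blinfun.add_left inner_diff_left inner_add_left)
    qed
    with g(1) show ?thesis by blast
  qed
  note kernel_singular_part_iff[OF pos_GX(2) Bplus_posop[OF tau_Bplus] tau_le this]
  moreover have "parallel_sum (ac_part G X) (X o\<^sub>L X) = par (X - tau G X) (X o\<^sub>L X)"
    by (simp only: parallel_sum_eq_par[OF ac_part_Bplus Bplus_square[OF X]] flip: ac_part_eq)
  moreover have "A \<in> Bplus0 \<longleftrightarrow> (\<forall>x. A x = 0 \<longrightarrow> x = 0)" if "A \<in> Bplus" for A :: "'a \<Rightarrow>\<^sub>L 'a"
    using that unfolding Bplus0_def by (auto simp: blinfun.zero_right)
  ultimately show ?thesis using tau_Bplus X by (simp only:)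
qed

end

text \<open>Superadditivity of \<open>[G]\<close> in disguise: the parts removed from
  \<open>X1\<close> and \<open>X2\<close> after \<open>n\<close> steps add up to an operator below
  \<open>X1 + X2\<close> and below \<open>2 n G\<close>, hence below
  \<open>[G](X1 + X2)\<close>.\<close>

lemma tau_subadditive:
  assumes G: "G \<in> Bplus" and X1: "X1 \<in> Bplus" and X2: "X2 \<in> Bplus"
  shows "op_le (tau G (X1 + X2)) (tau G X1 + tau G X2)"
proof -
  note X12 = Bplus_add[OF X1 X2]
  note pos = Bplus_posop[OF G] Bplus_posop[OF X1] Bplus_posop[OF X2]
  have D: "X1 - par_iter G X1 n + (X2 - par_iter G X2 n) \<in> Bplus" for n
    by (intro Bplus_add Bplus_diff X1 X2 par_iter_le pos) (simp_all add: mu_iterate G X1 X2)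
  have le: "X1 x \<bullet> x + X2 x \<bullet> x - par_iter G X1 n x \<bullet> x - par_iter G X2 n x \<bullet> x
      \<le> X1 x \<bullet> x + X2 x \<bullet> x - tau G (X1 + X2) x \<bullet> x" for n x
  proof -
    have form: "(X1 - par_iter G X1 n + (X2 - par_iter G X2 n)) x \<bullet> x =
        X1 x \<bullet> x + X2 x \<bullet> x - par_iter G X1 n x \<bullet> x - par_iter G X2 n x \<bullet> x" for x
      by (simp add: blinfun.diff_left blinfun.add_left inner_diff_left inner_add_left)
    have "(X1 - par_iter G X1 n + (X2 - par_iter G X2 n)) x \<bullet> x \<le> ac_part G (X1 + X2) x \<bullet> x"
    proof (rule form_le_ac_part[OF G X12 D])
      show "(X1 - par_iter G X1 n + (X2 - par_iter G X2 n)) x \<bullet> x \<le> (X1 + X2) x \<bullet> x" for x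
        unfolding form
        using posop_nonneg[OF par_iter_pos[OF pos(1,2)], of n x]
          posop_nonneg[OF par_iter_pos[OF pos(1,3)], of n x]
        by (simp add: blinfun.add_left inner_add_left)
      show "(X1 - par_iter G X1 n + (X2 - par_iter G X2 n)) x \<bullet> x \<le> (2 * real n) * (G x \<bullet> x)" for x
        unfolding form using par_iter_ge[OF pos(1,2), of x n] par_iter_ge[OF pos(1,3), of x n] by simp
    qed
    then show ?thesis
      unfolding ac_part_eq[OF G X12] form
      by (simp add: blinfun.diff_left blinfun.add_left inner_diff_left inner_add_left)
  qed
  have "tau G (X1 + X2) x \<bullet> x \<le> (tau G X1 + tau G X2) x \<bullet> x" for x
  proof -
    have "(\<lambda>n. par_iter G X1 n x \<bullet> x + par_iter G X2 n x \<bullet> x) \<longlonglongrightarrow> tau G X1 x \<bullet> x + tau G X2 x \<bullet> x"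
      by (intro tendsto_intros tau_limit G X1 X2)
    moreover have "tau G (X1 + X2) x \<bullet> x \<le> par_iter G X1 n x \<bullet> x + par_iter G X2 n x \<bullet> x" for n
      using le[of x n] by linarith
    ultimately have "tau G (X1 + X2) x \<bullet> x \<le> tau G X1 x \<bullet> x + tau G X2 x \<bullet> x"
      by (intro LIMSEQ_le_const) auto
    then show ?thesis by (simp add: blinfun.add_left inner_add_left)
  qed
  then show ?thesis
    unfolding op_le_iff[OF tau_Bplus[OF G X12] Bplus_add[OF tau_Bplus[OF G X1] tau_Bplus[OF G X2]]]
    by blast
qed

lemma form_le_if_range_sqrt_subset:
  assumes A: "A \<in> Bplus" and B: "B \<in> Bplus"
    and "range (op_sqrt A) \<subseteq> range (op_sqrt B)"
  obtains c where "\<And>x. A x \<bullet> x \<le> c * (B x \<bullet> x)"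
  by (rule square_le_if_range_subset[OF Bplus_posop[OF op_sqrt(1)[OF A]]
        Bplus_posop[OF op_sqrt(1)[OF B]] assms(3), unfolded op_sqrt(2)[OF A] op_sqrt(2)[OF B]])
    (rule that)

theorem theorem4p1:
  fixes G :: "'a::complex_hilbert \<Rightarrow>\<^sub>L 'a"
  assumes "G \<in> Bplus"
  shows
    "((\<forall>X\<in>Bplus. tau G X = X - ac_part G X) \<and>
      (\<forall>X\<in>Bplus. tau G X = 0 \<longleftrightarrow> abs_cont G X) \<and>
      (\<forall>X\<in>Bplus. tau G (ac_part G X) = 0) \<and>
      (\<forall>G'\<in>Bplus. range (blinfun_apply (op_sqrt G')) = range (blinfun_apply (op_sqrt G)) \<longrightarrow>
         (\<forall>X\<in>Bplus.
            tau G X = X - ac_part G' X \<and>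
            X - ac_part G' X = G' + X - ac_part G (G' + X) \<and>
            G' = ac_part G (G' + X) - ac_part G X \<and>
            X - tau G X = ac_part G (G' + X) - G')) \<and>
      (\<forall>X\<in>Bplus. strong_sums (\<lambda>n. parallel_sum ((mu G ^^ n) X) G) (ac_part G X)))
     \<and>
     (\<forall>X1\<in>Bplus. \<forall>X2\<in>Bplus. op_le (tau G (X1 + X2)) (tau G X1 + tau G X2))
     \<and>
     (\<forall>X\<in>Bplus.
        (tau G X \<in> Bplus0 \<longleftrightarrow>
           X \<in> Bplus0 \<and> parallel_sum (ac_part G X) (X o\<^sub>L X) = 0) \<and>
        (tau G X \<in> Bplus0 \<longleftrightarrow>
           G + X \<in> Bplus0 \<and> parallel_sum (ac_part G (G + X)) ((G + X) o\<^sub>L (G + X)) = 0))"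
proof (intro conjI ballI impI)
  note G = assms
  fix X :: "'a \<Rightarrow>\<^sub>L 'a" assume X: "X \<in> Bplus"
  show "tau G X = X - ac_part G X" by (simp add: ac_part_eq[OF G X])
  show "tau G X = 0 \<longleftrightarrow> abs_cont G X" by (rule tau_eq_0_iff[OF G X])
  show "tau G (ac_part G X) = 0"
    using tau_eq_0_iff[OF G ac_part_Bplus[OF G X]] abs_cont_ac_part[OF G X] by blast
  show "strong_sums (\<lambda>n. parallel_sum ((mu G ^^ n) X) G) (ac_part G X)"
    by (rule strong_sums_ac_part[OF G X])
  show "tau G X \<in> Bplus0 \<longleftrightarrow> X \<in> Bplus0 \<and> parallel_sum (ac_part G X) (X o\<^sub>L X) = 0"
    by (rule tau_Bplus0_iff[OF G X])
  have GX: "G + X \<in> Bplus" by (intro Bplus_add G X)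
  have "ac_part G (G + X) = G + X - tau G X"
    by (rule ac_part_add_eq[OF G X G G, of 1 1 1]) simp_all
  then have "tau G (G + X) = tau G X" using ac_part_eq[OF G GX] by simp
  then show "tau G X \<in> Bplus0 \<longleftrightarrow>
      G + X \<in> Bplus0 \<and> parallel_sum (ac_part G (G + X)) ((G + X) o\<^sub>L (G + X)) = 0"
    using tau_Bplus0_iff[OF G GX] by simp
next
  note G = assms
  fix G' X :: "'a \<Rightarrow>\<^sub>L 'a"
  assume G': "G' \<in> Bplus" and X: "X \<in> Bplus"
    and ran: "range (blinfun_apply (op_sqrt G')) = range (blinfun_apply (op_sqrt G))"
  obtain b where b: "\<And>x. G' x \<bullet> x \<le> b * (G x \<bullet> x)"
    by (rule form_le_if_range_sqrt_subset[OF G' G equalityD1[OF ran]]) (rule that)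
  obtain c where c: "\<And>x. G x \<bullet> x \<le> c * (G' x \<bullet> x)"
    by (rule form_le_if_range_sqrt_subset[OF G G' equalityD2[OF ran]]) (rule that)
  \<comment> \<open>\<open>G'\<close> replaces \<open>G\<close> in the parallel sums only; the
    iteration on the right is still that of \<open>G\<close>.\<close>
  have 1: "ac_part G' X = X - tau G X"
    using ac_part_add_eq[OF G X G' Bplus_zero b c, of 0] by simp
  \<comment> \<open>Now \<open>G'\<close> is the summand \<open>Y\<close>, dominated by
    \<open>b\<close> times \<open>G\<close>.\<close>
  have 2: "ac_part G (G' + X) = G' + X - tau G X"
    by (rule ac_part_add_eq[OF G X G G' _ _ b, of 1 1]) simp_all
  show "tau G X = X - ac_part G' X"
    and "X - ac_part G' X = G' + X - ac_part G (G' + X)"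
    and "G' = ac_part G (G' + X) - ac_part G X"
    and "X - tau G X = ac_part G (G' + X) - G'"
    by (simp_all add: 1 2 ac_part_eq[OF G X])
next
  fix X1 X2 :: "'a \<Rightarrow>\<^sub>L 'a" assume "X1 \<in> Bplus" "X2 \<in> Bplus"
  then show "op_le (tau G (X1 + X2)) (tau G X1 + tau G X2)" by (rule tau_subadditive[OF assms])
qed

end
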